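(* Let $N\in\mathbb{Z}$ and let $D_N$ be the quantum d-bar operator $D$ of the noncommutative disk, acting in the Hilbert space $\mathcal{H}$, with domain $$\mathrm{dom}(D_N)=\{a\in \mathrm{Dom}(D) : r(a)\in \mathrm{Ran}\,P_N\}.$$ Then $D_N$ is an unbounded Fredholm operator with index $\mathrm{ind}(D_N)=N+1$. In fact, there is a bounded operator $Q_N$ on $\mathcal{H}$ such that $\mathrm{Ker}(Q_N)=\mathrm{Coker}(D_N)$, $D_NQ_N=I-\mathrm{Proj}_{\mathrm{Coker}(D_N)}$, and $Q_ND_N=I-\mathrm{Proj}_{\mathrm{Ker}(D_N)}$ (on $\mathrm{dom}(D_N)$). Moreover $Q_N$ is a compact operator.
   Context: Setting (noncommutative disk). Let $\mathbb{N}=\{0,1,2,\dots\}$, let $\{e_k\}_{k\in\mathbb{N}}$ be the canonical orthonormal basis of $\ell^2(\mathbb{N})$, and let $\{w_k\}_{k\in\mathbb{N}}$ be a bounded sequence of positive numbers. Put $U_We_k=w_ke_{k+1}$ (unilateral weighted shift), $Ue_k=e_{k+1}$, and $S=[U_W^*,U_W]=U_W^*U_W-U_WU_W^*$, so $Se_k=s_ke_k$ with $s_k=w_k^2-w_{k-1}^2$, where $w_{-1}=0$. Standing assumptions: (1) there is $\epsilon>0$ with $w_k\ge\epsilon$ for all $k$; (2) $S\ge 0$; (3) $S$ is injective. (So $w_k$ is strictly increasing and $S$ is trace class.) Hilbert space. Let $C^*(W)$ be the $C^*$-algebra generated by $U_W$, and let $\mathcal{H}$ be its completion with respect to the inner product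 $\langle a,b\rangle_S=\mathrm{tr}(S^{1/2}bS^{1/2}a^* )$. Concretely, elements of $\mathcal{H}$ are the matrices $(a_{ij})_{i,j\in\mathbb{N}}$ with $\sum_{i,j}s_i^{1/2}s_j^{1/2}|a_{ij}|^2<\infty$. Operator $D$. $Da=S^{-1/2}[a,U_W]S^{-1/2}$ (computed entrywise on matrices), with domain $\mathrm{Dom}(D)$ the set of $a\in\mathcal{H}$ for which $S^{1/2}(Da)S^{1/2}(Da)^*$ is trace class, i.e. $Da\in\mathcal{H}$. Fourier expansion and boundary map. For a function $f$ on $\mathbb{N}$ let $f(K)$ be the diagonal operator $f(K)e_k=f(k)e_k$. Every $a\in\mathcal{H}$ has a unique expansion $a=\sum_{m=0}^\infty U^mf_m(K)+\sum_{n=1}^\infty g_n(K)(U^* )^n$. For $a\in\mathrm{Dom}(D)$ the limits $f_m(\infty)=\lim_{k\to\infty}f_m(k)$ and $g_n(\infty)=\lim_{k\to\infty}g_n(k)$ exist, and the boundary restriction is $$r(a)=\sum_{m=0}^\infty f_m(\infty)e^{im\varphi}+\sum_{n=1}^\infty g_n(\infty)e^{-in\varphi}$$ (it extends the quotient map $r:C^*(W)\to C(S^1)$ by the compact operators, with $r(U)=e^{i\varphi}$). $P_N$ is the orthogonal projection in $L^2(S^1)$ onto the closed span of $\{e^{in\varphi}\}_{n\le N}$; thus $r(a)\in\mathrm{Ran}\,P_N$ means that the coefficient of $e^{ij\varphi}$ in $r(a)$ vanishes for all $j>N$. A (densely defined) unbounded operator is Fredholm if it is closed, has closed range, and has finite-dimensional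 kernel and cokernel; its index is $\dim\mathrm{Ker}-\dim\mathrm{Coker}$. $\mathrm{Coker}(D_N)$ is identified with the orthogonal complement of the range of $D_N$, and $\mathrm{Proj}_V$ denotes orthogonal projection onto a closed subspace $V$. *)

theory Defs
  imports "HOL-Analysis.Analysis" "HOL-Library.Function_Algebras"
begin

section \<open>Infinite matrices\<close>

text \<open>
  Operators on \<open>\<ell>\<^sup>2(\<nat>)\<close> and elements of the Hilbert space below are both represented by their
  matrices \<open>a i j = \<langle>e\<^sub>i, a e\<^sub>j\<rangle>\<close>.  Addition, subtraction and zero are the pointwise ones of
  \<^theory>\<open>HOL-Library.Function_Algebras\<close>; the product of operators is \<open>mmul\<close>, not the
  pointwise product of that theory.
\<close>

type_synonym cmat = "nat \<Rightarrow> nat \<Rightarrow> complex"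

definition mscale :: "complex \<Rightarrow> cmat \<Rightarrow> cmat"
  where "mscale c a = (\<lambda>i j. c * a i j)"

global_interpretation cmat: vector_space mscale
  by unfold_locales (auto simp: mscale_def fun_eq_iff algebra_simps)

definition mmul :: "cmat \<Rightarrow> cmat \<Rightarrow> cmat"  (infixl \<open>\<odot>\<close> 70)
  where "a \<odot> b = (\<lambda>i j. \<Sum>\<^sub>\<infinity>k. a i k * b k j)"

definition madj :: "cmat \<Rightarrow> cmat"
  where "madj a = (\<lambda>i j. cnj (a j i))"

definition mtrace :: "cmat \<Rightarrow> complex"
  where "mtrace a = (\<Sum>\<^sub>\<infinity>k. a k k)"

definition mdiag :: "(nat \<Rightarrow> real) \<Rightarrow> cmat"
  where "mdiag f = (\<lambda>i j. if i = j then complex_of_real (f i) else 0)"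

lemma infsum_single:
  fixes f :: "nat \<Rightarrow> complex"
  assumes "\<And>k. k \<noteq> n \<Longrightarrow> f k = 0"
  shows "(\<Sum>\<^sub>\<infinity>k. f k) = f n"
proof -
  have "infsum f UNIV = infsum f {n}"
    by (rule infsum_cong_neutral) (auto simp: assms)
  then show ?thesis by simp
qed

lemma mdiag_mmul: "(mdiag f \<odot> a) i j = complex_of_real (f i) * a i j"
  unfolding mmul_def by (subst infsum_single[of i]) (auto simp: mdiag_def)

lemma mmul_mdiag: "(a \<odot> mdiag f) i j = a i j * complex_of_real (f j)"
  unfolding mmul_def by (subst infsum_single[of j]) (auto simp: mdiag_def)


section \<open>Operators on \<open>\<ell>\<^sup>2(\<nat>)\<close>\<close>

definition ell2 :: "(nat \<Rightarrow> complex) set"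
  where "ell2 = {x. (\<lambda>k. (cmod (x k))\<^sup>2) summable_on UNIV}"

definition ell2_inner :: "(nat \<Rightarrow> complex) \<Rightarrow> (nat \<Rightarrow> complex) \<Rightarrow> complex"
  where "ell2_inner x y = (\<Sum>\<^sub>\<infinity>k. cnj (x k) * y k)"

definition mapply :: "cmat \<Rightarrow> (nat \<Rightarrow> complex) \<Rightarrow> (nat \<Rightarrow> complex)"
  where "mapply a x = (\<lambda>i. \<Sum>\<^sub>\<infinity>j. a i j * x j)"

definition positive_operator :: "cmat \<Rightarrow> bool"
  where "positive_operator a \<longleftrightarrow>
    (\<forall>x\<in>ell2. \<exists>r\<ge>0. ell2_inner x (mapply a x) = complex_of_real r)"


section \<open>The noncommutative disk\<close>

definition weighted_shift :: "(nat \<Rightarrow> real) \<Rightarrow> cmat"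
  where "weighted_shift w = (\<lambda>i j. if i = Suc j then complex_of_real (w j) else 0)"

definition S_op :: "(nat \<Rightarrow> real) \<Rightarrow> cmat"
  where "S_op w = madj (weighted_shift w) \<odot> weighted_shift w
                - weighted_shift w \<odot> madj (weighted_shift w)"

definition s_seq :: "(nat \<Rightarrow> real) \<Rightarrow> nat \<Rightarrow> real"
  where "s_seq w k = (w k)\<^sup>2 - (if k = 0 then 0 else (w (k - 1))\<^sup>2)"

text \<open>This identity is what justifies the definitions of \<open>S_sqrt\<close> and \<open>S_inv_sqrt\<close>.\<close>

lemma S_op_eq_mdiag: "S_op w = mdiag (s_seq w)"
proof (intro ext)
  fix i j
  have 1: "(madj (weighted_shift w) \<odot> weighted_shift w) i j
      = (if i = j then complex_of_real ((w i)\<^sup>2) else 0)"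
    unfolding mmul_def
    by (subst infsum_single[of "Suc i"])
       (auto simp: madj_def weighted_shift_def power2_eq_square)
  have 2: "(weighted_shift w \<odot> madj (weighted_shift w)) i j
      = (if i = j \<and> i \<noteq> 0 then complex_of_real ((w (i - 1))\<^sup>2) else 0)"
    unfolding mmul_def
    by (subst infsum_single[of "i - 1"])
       (auto simp: madj_def weighted_shift_def power2_eq_square)
  show "S_op w i j = mdiag (s_seq w) i j"
    using 1 2 by (simp add: S_op_def mdiag_def s_seq_def)
qed

definition S_sqrt :: "(nat \<Rightarrow> real) \<Rightarrow> cmat"
  where "S_sqrt w = mdiag (\<lambda>k. sqrt (s_seq w k))"

definition S_inv_sqrt :: "(nat \<Rightarrow> real) \<Rightarrow> cmat"
  where "S_inv_sqrt w = mdiag (\<lambda>k. 1 / sqrt (s_seq w k))"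

definition nc_space :: "(nat \<Rightarrow> real) \<Rightarrow> cmat set"
  where "nc_space w =
    {a. (\<lambda>(i, j). sqrt (s_seq w i) * sqrt (s_seq w j) * (cmod (a i j))\<^sup>2) summable_on UNIV}"

text \<open>Conjugate linear in the first argument.\<close>

definition nc_inner :: "(nat \<Rightarrow> real) \<Rightarrow> cmat \<Rightarrow> cmat \<Rightarrow> complex"
  where "nc_inner w a b = mtrace (S_sqrt w \<odot> b \<odot> S_sqrt w \<odot> madj a)"

lemma nc_inner_eq:
  "nc_inner w a b =
    (\<Sum>\<^sub>\<infinity>i. \<Sum>\<^sub>\<infinity>j. complex_of_real (sqrt (s_seq w i) * sqrt (s_seq w j)) * (b i j * cnj (a i j)))"
  unfolding nc_inner_def mtrace_def mmul_def[of "_ \<odot> _" "madj a"] S_sqrt_def mmul_mdiag mdiag_mmul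
  by (simp add: madj_def mult_ac)

definition D_op :: "(nat \<Rightarrow> real) \<Rightarrow> cmat \<Rightarrow> cmat"
  where "D_op w a =
    S_inv_sqrt w \<odot> (a \<odot> weighted_shift w - weighted_shift w \<odot> a) \<odot> S_inv_sqrt w"

definition Dom_D :: "(nat \<Rightarrow> real) \<Rightarrow> cmat set"
  where "Dom_D w = {a \<in> nc_space w. D_op w a \<in> nc_space w}"

text \<open>
  \<open>fourier a j\<close> is the coefficient function of the \<open>j\<close>-th diagonal in the expansion
  \<open>a = \<Sum>\<^sub>m U\<^sup>m f\<^sub>m(K) + \<Sum>\<^sub>n g\<^sub>n(K) (U\<^sup>*)\<^sup>n\<close>: it is \<open>f\<^sub>j\<close> for \<open>j \<ge> 0\<close>, and \<open>g\<^sub>-\<^sub>j\<close> for \<open>j < 0\<close>.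
  As \<open>U\<^sup>m f(K) e\<^sub>k = f(k) e\<^sub>k\<^sub>+\<^sub>m\<close> and \<open>g(K) (U\<^sup>*)\<^sup>n e\<^sub>k\<^sub>+\<^sub>n = g(k) e\<^sub>k\<close>, these values are the
  matrix entries at \<open>(k + m, k)\<close> and at \<open>(k, k + n)\<close>.
\<close>

definition fourier :: "cmat \<Rightarrow> int \<Rightarrow> nat \<Rightarrow> complex"
  where "fourier a j k = (if j \<ge> 0 then a (k + nat j) k else a k (k + nat (- j)))"

text \<open>The coefficient of \<open>e\<^sup>i\<^sup>j\<^sup>\<phi>\<close> in the boundary restriction \<open>r(a)\<close>; the limit exists on \<open>Dom_D w\<close>.\<close>

definition boundary_coeff :: "cmat \<Rightarrow> int \<Rightarrow> complex"
  where "boundary_coeff a j = lim (fourier a j)"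

text \<open>\<open>r(a)\<close> lies in the range of \<open>P\<^sub>N\<close>.\<close>

definition dom_D_N :: "(nat \<Rightarrow> real) \<Rightarrow> int \<Rightarrow> cmat set"
  where "dom_D_N w N = {a \<in> Dom_D w. \<forall>j>N. boundary_coeff a j = 0}"


section \<open>Operators in a Hilbert space of matrices\<close>

text \<open>
  A Hilbert space is given by its carrier \<open>X\<close> and its inner product \<open>ip\<close>.  An unbounded operator
  is a function \<open>A\<close> together with a domain \<open>V \<subseteq> X\<close>; values of \<open>A\<close> outside \<open>V\<close> are ignored.
\<close>

type_synonym inner_prod = "cmat \<Rightarrow> cmat \<Rightarrow> complex"

definition ip_norm :: "inner_prod \<Rightarrow> cmat \<Rightarrow> real"
  where "ip_norm ip a = sqrt (Re (ip a a))"

definition ip_topology :: "cmat set \<Rightarrow> inner_prod \<Rightarrow> cmat topology"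
  where "ip_topology X ip = Metric_space.mtopology X (\<lambda>a b. ip_norm ip (a - b))"

definition orth_complement :: "cmat set \<Rightarrow> inner_prod \<Rightarrow> cmat set \<Rightarrow> cmat set"
  where "orth_complement X ip V = {b \<in> X. \<forall>v\<in>V. ip v b = 0}"

definition orth_proj :: "inner_prod \<Rightarrow> cmat set \<Rightarrow> cmat \<Rightarrow> cmat"
  where "orth_proj ip V a = (THE p. p \<in> V \<and> (\<forall>v\<in>V. ip v (a - p) = 0))"

definition fin_dim :: "cmat set \<Rightarrow> bool"
  where "fin_dim V \<longleftrightarrow> (\<exists>B. finite B \<and> V \<subseteq> cmat.span B)"

definition operator_on :: "cmat set \<Rightarrow> cmat set \<Rightarrow> (cmat \<Rightarrow> cmat) \<Rightarrow> bool"
  where "operator_on X V A \<longleftrightarrow>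
    V \<subseteq> X \<and> cmat.subspace V \<and> A ` V \<subseteq> X \<and>
    (\<forall>a\<in>V. \<forall>b\<in>V. A (a + b) = A a + A b) \<and>
    (\<forall>c. \<forall>a\<in>V. A (mscale c a) = mscale c (A a))"

definition op_kernel :: "cmat set \<Rightarrow> (cmat \<Rightarrow> cmat) \<Rightarrow> cmat set"
  where "op_kernel V A = {a \<in> V. A a = 0}"

text \<open>The cokernel, identified with the orthogonal complement of the range.\<close>

definition op_coker :: "cmat set \<Rightarrow> inner_prod \<Rightarrow> cmat set \<Rightarrow> (cmat \<Rightarrow> cmat) \<Rightarrow> cmat set"
  where "op_coker X ip V A = orth_complement X ip (A ` V)"

definition densely_defined :: "cmat set \<Rightarrow> inner_prod \<Rightarrow> cmat set \<Rightarrow> bool"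
  where "densely_defined X ip V \<longleftrightarrow> ip_topology X ip closure_of V = X"

definition closed_operator :: "cmat set \<Rightarrow> inner_prod \<Rightarrow> cmat set \<Rightarrow> (cmat \<Rightarrow> cmat) \<Rightarrow> bool"
  where "closed_operator X ip V A \<longleftrightarrow>
    closedin (prod_topology (ip_topology X ip) (ip_topology X ip)) ((\<lambda>a. (a, A a)) ` V)"

definition fredholm :: "cmat set \<Rightarrow> inner_prod \<Rightarrow> cmat set \<Rightarrow> (cmat \<Rightarrow> cmat) \<Rightarrow> bool"
  where "fredholm X ip V A \<longleftrightarrow>
    operator_on X V A \<and> densely_defined X ip V \<and> closed_operator X ip V A \<and>
    closedin (ip_topology X ip) (A ` V) \<and>
    fin_dim (op_kernel V A) \<and> fin_dim (op_coker X ip V A)"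

definition fredholm_index :: "cmat set \<Rightarrow> inner_prod \<Rightarrow> cmat set \<Rightarrow> (cmat \<Rightarrow> cmat) \<Rightarrow> int"
  where "fredholm_index X ip V A =
    int (cmat.dim (op_kernel V A)) - int (cmat.dim (op_coker X ip V A))"

definition bounded_operator :: "cmat set \<Rightarrow> inner_prod \<Rightarrow> (cmat \<Rightarrow> cmat) \<Rightarrow> bool"
  where "bounded_operator X ip Q \<longleftrightarrow>
    operator_on X X Q \<and> (\<exists>C. \<forall>a\<in>X. ip_norm ip (Q a) \<le> C * ip_norm ip a)"

definition compact_operator :: "cmat set \<Rightarrow> inner_prod \<Rightarrow> (cmat \<Rightarrow> cmat) \<Rightarrow> bool"
  where "compact_operator X ip Q \<longleftrightarrow>
    operator_on X X Q \<and>
    compactin (ip_topology X ip)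
      (ip_topology X ip closure_of (Q ` {a \<in> X. ip_norm ip a \<le> 1}))"

end

theory Submission
  imports Defs
begin

text \<open>
  Let \<open>\<Pi>\<close> be the diagonal operator with entries \<open>\<Pi>\<^sub>k = w\<^sub>0 \<dots> w\<^sub>k\<^sub>-\<^sub>1\<close> (\<open>wprod k\<close>).  Then \<open>U\<^sub>W = \<Pi> U \<Pi>\<^sup>-\<^sup>1\<close>, so for
  \<open>h = \<Pi>\<^sup>-\<^sup>1 a \<Pi>\<close> the commutator \<open>[a, U\<^sub>W]\<close> is conjugate to \<open>[h, U]\<close>, whose \<open>(i, j)\<close> entry is the
  difference \<open>h\<^sub>i\<^sub>,\<^sub>j\<^sub>+\<^sub>1 - h\<^sub>i\<^sub>-\<^sub>1\<^sub>,\<^sub>j\<close>.  Hence \<open>D\<close> is a weighted difference operator along each diagonal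
  and moves the diagonal \<open>d = i - j\<close> to \<open>d + 1\<close>; it is inverted by summation along the diagonals.

  Summing from the edge of the matrix for \<open>d < 0\<close> and from infinity for \<open>d \<ge> 0\<close> gives an operator
  \<open>primitive\<close> with \<open>D (primitive b) = b\<close> (\<open>D_op_primitive\<close>).  As \<open>w\<close> increases, the
  coefficients of these sums, relative to the weight \<open>S\<^sub>i\<^sup>1\<^sup>/\<^sup>2 S\<^sub>j\<^sup>1\<^sup>/\<^sup>2\<close> of the inner product, are at most
  \<open>1 / \<epsilon>\<close>.  By the Cauchy-Schwarz inequality the norm of \<open>primitive\<close> from one diagonal to its
  neighbour is then at most \<open>1 / \<epsilon>\<close> times the geometric mean of their total weights.  The total weight
  of a diagonal tends to zero away from the main diagonal because \<open>S\<close> is trace class, so \<open>primitive\<close> maps the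
  unit ball to a set with uniformly small tails, which is relatively compact
  (\<open>primitive_tails\<close>, \<open>compactin_uniform_tails\<close>).

  A solution of \<open>D z = 0\<close> vanishes on the diagonals \<open>d < 0\<close> and is a multiple of \<open>U\<^sub>W\<^sup>d\<close> on the diagonals
  \<open>d \<ge> 0\<close>, with nonzero boundary value there.  The boundary coefficients of \<open>primitive b\<close> vanish for
  \<open>d \<ge> 0\<close>, and for \<open>d < 0\<close> they are multiples of the inner product of \<open>(U\<^sub>W\<^sup>*)\<^sup>-\<^sup>d\<^sup>-\<^sup>1\<close> with \<open>b\<close>.
  Writing \<open>a = z + primitive (D a)\<close>, the condition that the coefficients above \<open>N\<close> vanish becomes
  \<open>z \<in> E\<close> and \<open>D a \<bottom> C\<close>, where \<open>E\<close> is spanned by \<open>U\<^sub>W\<^sup>d\<close> for \<open>0 \<le> d \<le> N\<close>, and \<open>C\<close> by \<open>(U\<^sub>W\<^sup>*)\<^sup>m\<close> for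
  \<open>0 \<le> m \<le> -N - 2\<close> (\<open>dom_D_N_eq\<close>).  So \<open>E\<close> is the kernel, \<open>C\<close> is the cokernel, the index is
  \<open>N + 1\<close>, and \<open>Q\<^sub>N = (I - Proj\<^sub>E) primitive (I - Proj\<^sub>C)\<close>.  This last deduction is pure Hilbert space
  theory and is made for abstract operators in \<open>fredholm_of_compact_right_inverse\<close>.
\<close>

section \<open>Fredholm operators built from a compact right inverse\<close>

text \<open>
  Inner products on a linear space \<open>X\<close> of matrices.  The metric of \<^const>\<open>ip_topology\<close> is built from
  \<open>ip (a - b) (a - b)\<close>, and the metric space axioms of nonnegativity and symmetry range over all
  matrices, inside \<open>X\<close> or not; the last two assumptions provide them.
\<close>

locale ip_space =
  fixes X :: "cmat set" and ip :: inner_prod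
  assumes subsp: "cmat.subspace X"
    and ip_add_right: "\<lbrakk>a \<in> X; b \<in> X; c \<in> X\<rbrakk> \<Longrightarrow> ip a (b + c) = ip a b + ip a c"
    and ip_scale_right: "\<lbrakk>a \<in> X; b \<in> X\<rbrakk> \<Longrightarrow> ip a (mscale z b) = z * ip a b"
    and ip_commute: "\<lbrakk>a \<in> X; b \<in> X\<rbrakk> \<Longrightarrow> ip b a = cnj (ip a b)"
    and ip_pos: "\<lbrakk>a \<in> X; a \<noteq> 0\<rbrakk> \<Longrightarrow> 0 < Re (ip a a)"
    and ip_nonneg: "0 \<le> Re (ip a a)"
    and ip_minus: "ip (- a) (- a) = ip a a"
begin

lemma zero_mem [simp]: "0 \<in> X"
  by (rule cmat.subspace_0[OF subsp])

lemma add_mem [simp]: "\<lbrakk>a \<in> X; b \<in> X\<rbrakk> \<Longrightarrow> a + b \<in> X"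
  by (rule cmat.subspace_add[OF subsp])

lemma diff_mem [simp]: "\<lbrakk>a \<in> X; b \<in> X\<rbrakk> \<Longrightarrow> a - b \<in> X"
  by (rule cmat.subspace_diff[OF subsp])

lemma scale_mem [simp]: "a \<in> X \<Longrightarrow> mscale z a \<in> X"
  by (rule cmat.subspace_scale[OF subsp])

lemma ip_zero_right [simp]: "a \<in> X \<Longrightarrow> ip a 0 = 0"
  using ip_scale_right[of a a 0] by simp

lemma ip_diff_right: "\<lbrakk>a \<in> X; b \<in> X; c \<in> X\<rbrakk> \<Longrightarrow> ip a (b - c) = ip a b - ip a c"
  using ip_add_right[of a "b - c" c] by simp

lemma ip_add_left: "\<lbrakk>a \<in> X; b \<in> X; c \<in> X\<rbrakk> \<Longrightarrow> ip (b + c) a = ip b a + ip c a"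
  using ip_add_right[of a b c] ip_commute[of a "b + c"] ip_commute[of a b] ip_commute[of a c]
  by simp

lemma ip_scale_left: "\<lbrakk>a \<in> X; b \<in> X\<rbrakk> \<Longrightarrow> ip (mscale z b) a = cnj z * ip b a"
  using ip_scale_right[of a b z] ip_commute[of a "mscale z b"] ip_commute[of a b] by simp

lemma ip_self_real: "a \<in> X \<Longrightarrow> ip a a = complex_of_real (Re (ip a a))"
proof -
  assume "a \<in> X"
  then have "Im (ip a a) = Im (cnj (ip a a))"
    by (intro arg_cong[where f = Im] ip_commute)
  then show ?thesis
    by (simp add: complex_eq_iff)
qed

lemma ip_self_eq_0: "a \<in> X \<Longrightarrow> ip a a = 0 \<longleftrightarrow> a = 0"
  using ip_pos[of a] by (cases "a = 0") auto

abbreviation nrm :: "cmat \<Rightarrow> real"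
  where "nrm \<equiv> ip_norm ip"

lemma nrm_sq: "(nrm a)\<^sup>2 = Re (ip a a)"
  by (simp add: ip_norm_def ip_nonneg)

lemma nrm_nonneg [simp]: "0 \<le> nrm a"
  by (simp add: ip_norm_def ip_nonneg)

lemma nrm_zero [simp]: "nrm 0 = 0"
  by (simp add: ip_norm_def)

lemma nrm_minus: "nrm (- a) = nrm a"
  by (simp add: ip_norm_def ip_minus)

lemma nrm_diff_commute: "nrm (a - b) = nrm (b - a)"
  using nrm_minus[of "a - b"] by simp

lemma nrm_eq_0 [simp]: "a \<in> X \<Longrightarrow> nrm a = 0 \<longleftrightarrow> a = 0"
  using ip_pos[of a] by (cases "a = 0") (auto simp: ip_norm_def)

lemma nrm_scale: "a \<in> X \<Longrightarrow> nrm (mscale z a) = cmod z * nrm a"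
proof -
  assume a: "a \<in> X"
  have "ip (mscale z a) (mscale z a) = complex_of_real ((cmod z)\<^sup>2) * ip a a"
    using a by (simp add: ip_scale_left ip_scale_right complex_norm_square del: of_real_power)
  then have "Re (ip (mscale z a) (mscale z a)) = (cmod z)\<^sup>2 * Re (ip a a)"
    by simp
  then show ?thesis
    by (simp add: ip_norm_def real_sqrt_mult)
qed

lemma pythagoras:
  assumes "a \<in> X" "b \<in> X" "ip a b = 0"
  shows "(nrm (a + b))\<^sup>2 = (nrm a)\<^sup>2 + (nrm b)\<^sup>2"
proof -
  have "ip b a = 0"
    using assms by (simp add: ip_commute[of a b])
  then show ?thesis
    using assms by (simp add: nrm_sq ip_add_left ip_add_right)
qed

lemma Cauchy_Schwarz_ip:
  assumes "a \<in> X" "b \<in> X"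
  shows "cmod (ip a b) \<le> nrm a * nrm b"
proof (cases "a = 0")
  case True
  then show ?thesis
    using assms by (simp add: ip_commute[of b 0])
next
  case False
  define z where "z = ip a b / ip a a"
  have nz: "ip a a \<noteq> 0"
    using assms False ip_self_eq_0 by blast
  have "ip a (b - mscale z a) = 0"
    using assms nz by (simp add: ip_diff_right ip_scale_right z_def)
  then have "ip (mscale z a) (b - mscale z a) = 0"
    using assms by (simp add: ip_scale_left)
  from pythagoras[OF _ _ this]
  have "(nrm b)\<^sup>2 \<ge> (nrm (mscale z a))\<^sup>2"
    using assms by simp
  then have "cmod z * nrm a \<le> nrm b"
    using assms power2_le_imp_le[of "nrm (mscale z a)" "nrm b"] by (simp add: nrm_scale)
  moreover have "cmod z = cmod (ip a b) / (nrm a)\<^sup>2"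
  proof -
    have "cmod (ip a a) = (nrm a)\<^sup>2"
      unfolding nrm_sq by (subst ip_self_real[OF assms(1)]) (simp add: ip_nonneg)
    then show ?thesis
      by (simp add: z_def norm_divide)
  qed
  moreover have "nrm a > 0"
    using nrm_eq_0[OF assms(1)] False nrm_nonneg[of a] by linarith
  ultimately show ?thesis
    by (simp add: power2_eq_square field_simps)
qed

lemma nrm_triangle: "nrm (a + b) \<le> nrm a + nrm b" if "a \<in> X" "b \<in> X"
proof -
  have "Re (ip b a) = Re (ip a b)"
    using that by (simp add: ip_commute[of a b])
  then have "(nrm (a + b))\<^sup>2 = (nrm a)\<^sup>2 + (nrm b)\<^sup>2 + 2 * Re (ip a b)"
    using that by (simp add: nrm_sq ip_add_left ip_add_right)
  also have "\<dots> \<le> (nrm a)\<^sup>2 + (nrm b)\<^sup>2 + 2 * (nrm a * nrm b)"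
    using Cauchy_Schwarz_ip[OF that] complex_Re_le_cmod[of "ip a b"] by linarith
  also have "\<dots> = (nrm a + nrm b)\<^sup>2"
    by (simp add: power2_sum)
  finally show ?thesis
    by (rule power2_le_imp_le) simp
qed

lemma nrm_diff_triangle: "nrm (a - b) \<le> nrm a + nrm b" if "a \<in> X" "b \<in> X"
proof -
  have "nrm (a - b) \<le> nrm a + nrm (0 - b)"
    using nrm_triangle[of a "0 - b"] that diff_mem[of 0 b] by simp
  then show ?thesis
    using nrm_diff_commute[of 0 b] that by simp
qed


sublocale M: Metric_space X "\<lambda>a b. nrm (a - b)"
proof
  fix a b c
  assume "a \<in> X" "b \<in> X" "c \<in> X"
  then show "nrm (a - c) \<le> nrm (a - b) + nrm (b - c)"
    using nrm_triangle[of "a - b" "b - c"] by simp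
next
  fix a b
  show "nrm (a - b) = nrm (b - a)"
    by (rule nrm_diff_commute)
qed simp_all

lemma ip_topology_eq: "ip_topology X ip = M.mtopology"
  by (simp add: ip_topology_def)

lemma limitin_ip_iff:
  assumes "range \<sigma> \<subseteq> X"
  shows "limitin M.mtopology \<sigma> l sequentially \<longleftrightarrow> l \<in> X \<and> (\<lambda>n. nrm (\<sigma> n - l)) \<longlonglongrightarrow> 0"
proof -
  have "\<forall>\<^sub>F n in sequentially. \<sigma> n \<in> X"
    using assms by (intro always_eventually) auto
  then show ?thesis
    unfolding M.limitin_metric_dist_null by blast
qed

lemma continuous_map_of_bounded:
  assumes "operator_on X X L" and "\<And>a. a \<in> X \<Longrightarrow> nrm (L a) \<le> B * nrm a"
  shows "continuous_map M.mtopology M.mtopology L"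
proof -
  have img: "L ` X \<subseteq> X" and add: "\<And>a b. \<lbrakk>a \<in> X; b \<in> X\<rbrakk> \<Longrightarrow> L (a + b) = L a + L b"
    using assms(1) unfolding operator_on_def by blast+
  have diff: "L a - L b = L (a - b)" if "a \<in> X" "b \<in> X" for a b
    using add[of "a - b" b] diff_mem[OF that] that by simp
  show ?thesis
    unfolding M.metric_continuous_map[OF M.Metric_space_axioms]
  proof (intro conjI ballI allI impI)
    show "L ` X \<subseteq> X"
      by (rule img)
    fix a and e :: real
    assume a: "a \<in> X" and e: "0 < e"
    show "\<exists>\<delta>>0. \<forall>x. x \<in> X \<and> nrm (a - x) < \<delta> \<longrightarrow> nrm (L a - L x) < e"
    proof (intro exI[of _ "e / (\<bar>B\<bar> + 1)"] conjI allI impI)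
      fix x
      assume x: "x \<in> X \<and> nrm (a - x) < e / (\<bar>B\<bar> + 1)"
      have "nrm (L a - L x) \<le> B * nrm (a - x)"
        using assms(2)[of "a - x"] a x diff[of a x] by simp
      also have "\<dots> \<le> (\<bar>B\<bar> + 1) * nrm (a - x)"
        by (rule mult_right_mono) auto
      also have "\<dots> < e"
        using x by (simp add: pos_less_divide_eq mult.commute)
      finally show "nrm (L a - L x) < e" .
    qed (use e in auto)
  qed
qed

subsection \<open>Finite orthogonal families\<close>

text \<open>
  Orthogonal families are not normalised: the vectors that occur below, powers of \<open>U\<^sub>W\<close> and of its
  adjoint, have no convenient norms.
\<close>

definition orth_family :: "cmat set \<Rightarrow> bool"
  where "orth_family E \<longleftrightarrow>
    finite E \<and> E \<subseteq> X \<and> 0 \<notin> E \<and> (\<forall>e\<in>E. \<forall>f\<in>E. e \<noteq> f \<longrightarrow> ip e f = 0)"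

definition proj :: "cmat set \<Rightarrow> cmat \<Rightarrow> cmat"
  where "proj E a = (\<Sum>e\<in>E. mscale (ip e a / ip e e) e)"

lemma sum_mem: "(\<And>e. e \<in> E \<Longrightarrow> f e \<in> X) \<Longrightarrow> sum f E \<in> X"
  by (rule cmat.subspace_sum[OF subsp])

lemma ip_sum_right:
  assumes "finite E" "a \<in> X" "\<And>e. e \<in> E \<Longrightarrow> f e \<in> X"
  shows "ip a (sum f E) = (\<Sum>e\<in>E. ip a (f e))"
  using assms(1,3)
proof (induction E)
  case empty
  show ?case
    unfolding sum.empty by (rule ip_zero_right[OF assms(2)])
next
  case (insert e E)
  have "sum f E \<in> X"
    using insert by (intro sum_mem) auto
  then have "ip a (f e + sum f E) = ip a (f e) + (\<Sum>e\<in>E. ip a (f e))"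
    using insert assms(2) ip_add_right[of a "f e" "sum f E"] by simp
  then show ?case
    unfolding sum.insert[OF insert(1,2)] .
qed

lemma span_mem: "orth_family E \<Longrightarrow> v \<in> cmat.span E \<Longrightarrow> v \<in> X"
  using cmat.span_minimal[OF _ subsp, of E] by (auto simp: orth_family_def)

lemma proj_span: "proj E a \<in> cmat.span E"
  unfolding proj_def by (intro cmat.span_sum cmat.span_scale cmat.span_base)

lemma proj_mem: "orth_family E \<Longrightarrow> proj E a \<in> X"
  using proj_span span_mem by blast

lemma ip_residual:
  assumes E: "orth_family E" and a: "a \<in> X" and e: "e \<in> E"
  shows "ip e (a - proj E a) = 0"
proof -
  have eX: "e \<in> X" and fin: "finite E" and EX: "\<And>f. f \<in> E \<Longrightarrow> f \<in> X" and nz: "ip e e \<noteq> 0"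
    using E e ip_self_eq_0 by (auto simp: orth_family_def)
  have "ip e (proj E a) = (\<Sum>f\<in>E. ip e (mscale (ip f a / ip f f) f))"
    unfolding proj_def by (intro ip_sum_right fin eX scale_mem EX)
  also have "\<dots> = (\<Sum>f\<in>E. if f = e then ip e a else 0)"
    using E e nz EX eX by (intro sum.cong) (auto simp: orth_family_def ip_scale_right)
  also have "\<dots> = ip e a"
    using fin e by simp
  finally show ?thesis
    using eX a proj_mem[OF E] by (simp add: ip_diff_right)
qed

lemma ip_span_eq_0:
  assumes E: "E \<subseteq> X" and b: "b \<in> X" and orth: "\<And>e. e \<in> E \<Longrightarrow> ip e b = 0"
    and v: "v \<in> cmat.span E"
  shows "ip v b = 0"
proof -
  have "cmat.subspace {v \<in> X. ip v b = 0}"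
    using b ip_commute[of b 0]
    by (auto simp: cmat.subspace_def ip_add_left ip_scale_left)
  then have "cmat.span E \<subseteq> {v \<in> X. ip v b = 0}"
    using E orth by (intro cmat.span_minimal) auto
  then show ?thesis
    using v by blast
qed

lemma residual_orth_span:
  assumes "orth_family E" "a \<in> X" "v \<in> cmat.span E"
  shows "ip v (a - proj E a) = 0"
proof (rule ip_span_eq_0[OF _ _ _ assms(3)])
  show "E \<subseteq> X"
    using assms(1) by (simp add: orth_family_def)
  show "a - proj E a \<in> X"
    using assms proj_mem by simp
qed (rule ip_residual[OF assms(1,2)])

lemma proj_unique:
  assumes E: "orth_family E" and a: "a \<in> X" and p: "p \<in> cmat.span E"
    and orth: "\<And>v. v \<in> cmat.span E \<Longrightarrow> ip v (a - p) = 0"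
  shows "p = proj E a"
proof -
  define v where "v = proj E a - p"
  have v: "v \<in> cmat.span E"
    unfolding v_def by (intro cmat.span_diff proj_span p)
  have "v = (a - p) - (a - proj E a)"
    by (simp add: v_def)
  then have "ip v v = ip v (a - p) - ip v (a - proj E a)"
    using ip_diff_right[of v "a - p" "a - proj E a"] span_mem[OF E v] span_mem[OF E p] a proj_mem[OF E]
    by simp
  then have "ip v v = 0"
    using orth[OF v] residual_orth_span[OF E a v] by simp
  then show ?thesis
    using ip_self_eq_0[OF span_mem[OF E v]] by (simp add: v_def)
qed

lemma orth_proj_span:
  assumes "orth_family E" "a \<in> X"
  shows "orth_proj ip (cmat.span E) a = proj E a"
  unfolding orth_proj_def
  using assms by (intro the_equality) (auto intro: proj_unique proj_span residual_orth_span)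

lemma proj_of_span: "orth_family E \<Longrightarrow> v \<in> cmat.span E \<Longrightarrow> proj E v = v"
  using proj_unique[of E v v] span_mem[of E] by simp

lemma proj_of_orth: "(\<And>e. e \<in> E \<Longrightarrow> ip e b = 0) \<Longrightarrow> proj E b = 0"
  by (simp add: proj_def)

lemma nrm_residual_le:
  assumes E: "orth_family E" and a: "a \<in> X"
  shows "nrm (a - proj E a) \<le> nrm a"
proof -
  have "(nrm (proj E a + (a - proj E a)))\<^sup>2 = (nrm (proj E a))\<^sup>2 + (nrm (a - proj E a))\<^sup>2"
    using E a by (intro pythagoras residual_orth_span proj_span) (simp_all add: proj_mem)
  then have "(nrm (a - proj E a))\<^sup>2 \<le> (nrm a)\<^sup>2"
    by simp
  then show ?thesis
    by (rule power2_le_imp_le) simp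
qed

lemma operator_on_residual:
  assumes E: "orth_family E"
  shows "operator_on X X (\<lambda>a. a - proj E a)"
proof -
  have EX: "\<And>e. e \<in> E \<Longrightarrow> e \<in> X"
    using E by (auto simp: orth_family_def)
  have "proj E (a + b) = proj E a + proj E b" if "a \<in> X" "b \<in> X" for a b
    unfolding proj_def sum.distrib[symmetric] cmat.scale_left_distrib[symmetric]
    using that EX by (intro sum.cong) (simp_all add: ip_add_right add_divide_distrib)
  moreover have "proj E (mscale z a) = mscale z (proj E a)" if "a \<in> X" for a z
    unfolding proj_def cmat.scale_sum_right
    using that EX by (intro sum.cong) (simp_all add: ip_scale_right)
  ultimately show ?thesis
    using proj_mem[OF E] subsp
    by (auto simp: operator_on_def cmat.scale_right_diff_distrib)
qed

lemma dim_span_orth_family: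
  assumes E: "orth_family E"
  shows "cmat.dim (cmat.span E) = card E"
proof -
  have fin: "finite E" and EX: "\<And>e. e \<in> E \<Longrightarrow> e \<in> X"
    using E by (auto simp: orth_family_def)
  have "u e = 0" if e: "e \<in> E" and 0: "(\<Sum>v\<in>E. mscale (u v) v) = 0" for u e
  proof -
    have "0 = ip e (\<Sum>v\<in>E. mscale (u v) v)"
      using 0 EX[OF e] by simp
    also have "\<dots> = (\<Sum>v\<in>E. ip e (mscale (u v) v))"
      using EX e fin by (intro ip_sum_right) auto
    also have "\<dots> = (\<Sum>v\<in>E. if v = e then u e * ip e e else 0)"
      using E e EX by (intro sum.cong) (auto simp: orth_family_def ip_scale_right)
    finally show ?thesis
      using fin e E ip_self_eq_0[OF EX[OF e]] by (auto simp: orth_family_def)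
  qed
  then have "cmat.independent E"
    by (auto simp: cmat.dependent_finite[OF fin])
  then show ?thesis
    by (rule cmat.dim_span_eq_card_independent)
qed

text \<open>
  The double complement of a finite family is its span, since a vector in it is orthogonal to its own
  residual.  It identifies the cokernel below, and it makes finite-dimensional subspaces closed
  without a compactness argument.
\<close>

lemma orth_complement_orth_complement:
  assumes E: "orth_family E"
  shows "orth_complement X ip (orth_complement X ip E) = cmat.span E"
proof (intro equalityI subsetI)
  fix b assume "b \<in> orth_complement X ip (orth_complement X ip E)"
  then have b: "b \<in> X" and orth: "\<And>v. v \<in> X \<Longrightarrow> \<forall>e\<in>E. ip e v = 0 \<Longrightarrow> ip v b = 0"
    by (auto simp: orth_complement_def)
  let ?r = "b - proj E b"
  have r: "?r \<in> X"
    using b proj_mem[OF E] by simp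
  have "ip ?r b = 0"
    using orth[OF r] ip_residual[OF E b] by blast
  moreover have "ip ?r (proj E b) = 0"
    using residual_orth_span[OF E b proj_span] ip_commute[OF proj_mem[OF E] r] by simp
  ultimately have "ip ?r ?r = 0"
    using ip_diff_right[OF r b proj_mem[OF E]] by simp
  then have "proj E b = b"
    using ip_self_eq_0[OF r] by simp
  then show "b \<in> cmat.span E"
    using proj_span[of E b] by simp
next
  fix b assume b: "b \<in> cmat.span E"
  have "ip v b = 0" if "v \<in> X" "\<forall>e\<in>E. ip e v = 0" for v
  proof -
    have "E \<subseteq> X"
      using E by (simp add: orth_family_def)
    then have "ip b v = 0"
      using that b by (intro ip_span_eq_0[of E v b]) blast+
    then show ?thesis
      using ip_commute[OF span_mem[OF E b] that(1)] by simp
  qed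
  then show "b \<in> orth_complement X ip (orth_complement X ip E)"
    unfolding orth_complement_def using span_mem[OF E b] by blast
qed

lemma closedin_orth_complement:
  assumes S: "S \<subseteq> X"
  shows "closedin M.mtopology (orth_complement X ip S)"
  unfolding M.metric_closedin_iff_sequentially_closed
proof (intro conjI allI impI)
  show "orth_complement X ip S \<subseteq> X"
    by (auto simp: orth_complement_def)
  fix \<sigma> :: "nat \<Rightarrow> cmat" and l
  assume *: "range \<sigma> \<subseteq> orth_complement X ip S \<and> limitin M.mtopology \<sigma> l sequentially"
  then have "\<sigma> n \<in> orth_complement X ip S" for n
    by blast
  then have \<sigma>: "\<sigma> n \<in> X" "\<And>v. v \<in> S \<Longrightarrow> ip v (\<sigma> n) = 0" for n
    by (simp_all add: orth_complement_def)
  then have "range \<sigma> \<subseteq> X"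
    by blast
  then have l: "l \<in> X" and lim: "(\<lambda>n. nrm (\<sigma> n - l)) \<longlonglongrightarrow> 0"
    using * limitin_ip_iff by blast+
  have "ip v l = 0" if v: "v \<in> S" for v
  proof -
    have vX: "v \<in> X"
      using v S by blast
    have "cmod (ip v l) \<le> nrm v * nrm (\<sigma> n - l)" for n
      using Cauchy_Schwarz_ip[OF vX diff_mem[OF \<sigma>(1) l], of n] ip_diff_right[OF vX \<sigma>(1) l, of n]
        \<sigma>(2)[OF v, of n] by simp
    moreover have "(\<lambda>n. nrm v * nrm (\<sigma> n - l)) \<longlonglongrightarrow> nrm v * 0"
      by (intro tendsto_mult tendsto_const lim)
    ultimately have "cmod (ip v l) \<le> nrm v * 0"
      by (intro LIMSEQ_le_const[where X = "\<lambda>n. nrm v * nrm (\<sigma> n - l)"]) auto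
    then show ?thesis
      by simp
  qed
  then show "l \<in> orth_complement X ip S"
    using l by (auto simp: orth_complement_def)
qed

lemma closedin_span:
  assumes "orth_family E"
  shows "closedin M.mtopology (cmat.span E)"
proof -
  have "orth_complement X ip E \<subseteq> X"
    by (simp add: orth_complement_def)
  from closedin_orth_complement[OF this] show ?thesis
    unfolding orth_complement_orth_complement[OF assms] .
qed

subsection \<open>Parametrices of operators with a compact right inverse\<close>

lemma operator_on_compose:
  assumes "operator_on X X P" "operator_on X X R"
  shows "operator_on X X (\<lambda>a. P (R a))"
  using assms unfolding operator_on_def by (simp add: image_subset_iff)

lemma operator_on_diff:
  assumes "operator_on X X L" "a \<in> X" "b \<in> X"
  shows "L (a - b) = L a - L b"
proof -
  have "L (a - b + b) = L (a - b) + L b"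
    using assms diff_mem[of a b] unfolding operator_on_def by blast
  then show ?thesis
    by simp
qed

lemma operator_on_zero: "operator_on X X L \<Longrightarrow> L 0 = 0"
  using operator_on_diff[of L 0 0] by simp

lemma closedin_limit:
  assumes "closedin M.mtopology S" "range \<sigma> \<subseteq> S" "limitin M.mtopology \<sigma> l sequentially"
  shows "l \<in> S"
  using assms unfolding M.metric_closedin_iff_sequentially_closed by blast

text \<open>
  Let \<open>R\<close> be a compact operator and let \<open>A\<close> be defined on \<open>span E + R (C\<^sup>\<bottom>)\<close>, zero on \<open>span E\<close> and a left
  inverse of \<open>R\<close> on \<open>C\<^sup>\<bottom>\<close>.  Its range is \<open>C\<^sup>\<bottom>\<close> and its kernel is \<open>span E\<close>, and every \<open>a\<close> in its domain
  differs from \<open>R (A a)\<close> by an element of the kernel.  The graph is closed because in a convergent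
  sequence of its points the kernel components \<open>a - R (A a)\<close> converge as well, by continuity of \<open>R\<close>, to
  an element of the closed subspace \<open>span E\<close>.  
  Removing the kernel component from \<open>R\<close> and precomposing with the projection onto the range gives the
  parametrix; compactness passes from \<open>R\<close> to it because the projections are contractions.
\<close>

theorem fredholm_of_compact_right_inverse:
  assumes E: "orth_family E" and C: "orth_family C"
    and R: "operator_on X X R" and R_bound: "\<And>b. b \<in> X \<Longrightarrow> nrm (R b) \<le> B * nrm b"
    and T: "compactin M.mtopology T" and R_ball: "R ` {b \<in> X. nrm b \<le> 1} \<subseteq> T"
    and V: "V = {e + R b | e b. e \<in> cmat.span E \<and> b \<in> orth_complement X ip C}"
    and A: "\<And>e b. \<lbrakk>e \<in> cmat.span E; b \<in> orth_complement X ip C\<rbrakk> \<Longrightarrow> A (e + R b) = b"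
    and dense: "densely_defined X ip V"
  shows "fredholm X ip V A"
    and "fredholm_index X ip V A = int (card E) - int (card C)"
    and "\<exists>Q. bounded_operator X ip Q \<and>
      op_kernel X Q = op_coker X ip V A \<and>
      (\<forall>a\<in>X. Q a \<in> V \<and> A (Q a) = a - orth_proj ip (op_coker X ip V A) a) \<and>
      (\<forall>a\<in>V. Q (A a) = a - orth_proj ip (op_kernel V A) a) \<and>
      compact_operator X ip Q"
proof -
  define P where "P = orth_complement X ip C"
  note V = V[folded P_def] and A = A[folded P_def]
  have CX: "C \<subseteq> X"
    using C by (simp add: orth_family_def)
  have PX: "b \<in> X" if "b \<in> P" for b
    using that by (simp add: P_def orth_complement_def)
  have EX: "e \<in> X" if "e \<in> cmat.span E" for e
    using span_mem[OF E that] .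
  have P_sub: "cmat.subspace P"
    using CX by (auto simp: P_def orth_complement_def cmat.subspace_def ip_add_right ip_scale_right)
  have R_add: "R (a + b) = R a + R b" and R_scale: "R (mscale z a) = mscale z (R a)"
    if "a \<in> X" "b \<in> X" for a b z
    using R that unfolding operator_on_def by blast+
  have RX: "R a \<in> X" if "a \<in> X" for a
    using R that unfolding operator_on_def by blast
  have R0: "R 0 = 0"
    by (rule operator_on_zero[OF R])
  have VI: "e + R b \<in> V" if "e \<in> cmat.span E" "b \<in> P" for e b
    using that V by blast
  have VX: "V \<subseteq> X"
    unfolding V using EX RX PX by auto
  have AV: "a \<in> V \<Longrightarrow> A a \<in> P \<and> a - R (A a) \<in> cmat.span E" for a
    using V A by auto
  have V_sub: "cmat.subspace V"
  proof (rule cmat.subspaceI)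
    show "0 \<in> V"
      using VI[OF cmat.span_zero cmat.subspace_0[OF P_sub]] R0 by simp
  next
    fix a b assume "a \<in> V" "b \<in> V"
    then obtain e c e' c' where *: "e \<in> cmat.span E" "c \<in> P" "a = e + R c"
        "e' \<in> cmat.span E" "c' \<in> P" "b = e' + R c'"
      unfolding V by blast
    have "a + b = (e + e') + R (c + c')"
      using * R_add[OF PX PX] by (simp add: add_ac)
    then show "a + b \<in> V"
      using VI[OF cmat.span_add[OF *(1,4)] cmat.subspace_add[OF P_sub *(2,5)]] by simp
  next
    fix z a assume "a \<in> V"
    then obtain e c where *: "e \<in> cmat.span E" "c \<in> P" "a = e + R c"
      unfolding V by blast
    have "mscale z a = mscale z e + R (mscale z c)"
      using * R_scale[OF PX PX] by (simp add: cmat.scale_right_distrib)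
    then show "mscale z a \<in> V"
      using VI[OF cmat.span_scale[OF *(1)] cmat.subspace_scale[OF P_sub *(2)]] by simp
  qed
  have A_add: "A (a + b) = A a + A b" if ab: "a \<in> V" "b \<in> V" for a b
  proof -
    obtain e c e' c' where *: "e \<in> cmat.span E" "c \<in> P" "a = e + R c"
        "e' \<in> cmat.span E" "c' \<in> P" "b = e' + R c'"
      using ab unfolding V by blast
    have eq: "a + b = (e + e') + R (c + c')"
      using * R_add[OF PX PX] by (simp add: add_ac)
    have "A a = c" "A b = c'"
      using * A by simp_all
    then show ?thesis
      unfolding eq using A[OF cmat.span_add[OF *(1,4)] cmat.subspace_add[OF P_sub *(2,5)]] by simp
  qed
  have A_scale: "A (mscale z a) = mscale z (A a)" if a: "a \<in> V" for a z
  proof -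
    obtain e c where *: "e \<in> cmat.span E" "c \<in> P" "a = e + R c"
      using a unfolding V by blast
    have eq: "mscale z a = mscale z e + R (mscale z c)"
      using * R_scale[OF PX PX] by (simp add: cmat.scale_right_distrib)
    have "A a = c"
      using * A by simp
    then show ?thesis
      unfolding eq using A[OF cmat.span_scale[OF *(1)] cmat.subspace_scale[OF P_sub *(2)]] by simp
  qed
  have opA: "operator_on X V A"
    unfolding operator_on_def using VX V_sub AV PX A_add A_scale by blast
  have range: "A ` V = P"
  proof
    show "A ` V \<subseteq> P"
      using AV by blast
    show "P \<subseteq> A ` V"
    proof
      fix b assume "b \<in> P"
      then show "b \<in> A ` V"
        using A[OF cmat.span_zero] VI[OF cmat.span_zero] by (intro image_eqI[of _ _ "0 + R b"]) simp_all
    qed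
  qed
  have ker: "op_kernel V A = cmat.span E"
  proof (intro equalityI subsetI)
    fix a assume "a \<in> op_kernel V A"
    then have "a \<in> V" "A a = 0"
      by (auto simp: op_kernel_def)
    then show "a \<in> cmat.span E"
      using AV[of a] R0 by simp
  next
    fix a assume a: "a \<in> cmat.span E"
    have "0 \<in> P"
      by (rule cmat.subspace_0[OF P_sub])
    then show "a \<in> op_kernel V A"
      using A[OF a, of 0] VI[OF a, of 0] R0 by (simp add: op_kernel_def)
  qed
  have coker: "op_coker X ip V A = cmat.span C"
    unfolding op_coker_def range by (simp add: P_def orth_complement_orth_complement[OF C])
  have P_closed: "closedin M.mtopology P"
    unfolding P_def by (rule closedin_orth_complement[OF CX])

  have "closed_operator X ip V A"
  proof -
    interpret Metric_space12 X "\<lambda>a b. nrm (a - b)" X "\<lambda>a b. nrm (a - b)" ..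
    have "closedin Prod_metric.mtopology ((\<lambda>a. (a, A a)) ` V)"
      unfolding Prod_metric.metric_closedin_iff_sequentially_closed
    proof (intro conjI allI impI)
      show "(\<lambda>a. (a, A a)) ` V \<subseteq> X \<times> X"
        using VX AV PX by auto
      fix \<sigma> :: "nat \<Rightarrow> cmat \<times> cmat" and l
      assume *: "range \<sigma> \<subseteq> (\<lambda>a. (a, A a)) ` V \<and> limitin Prod_metric.mtopology \<sigma> l sequentially"
      define s where "s = fst \<circ> \<sigma>"
      have sV: "s n \<in> V" and snd: "snd (\<sigma> n) = A (s n)" for n
      proof -
        have "\<sigma> n \<in> (\<lambda>a. (a, A a)) ` V"
          using * by blast
        then show "s n \<in> V" "snd (\<sigma> n) = A (s n)"
          by (auto simp: s_def)
      qed
      have sndf: "snd \<circ> \<sigma> = (\<lambda>n. A (s n))"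
        by (simp add: fun_eq_iff snd)
      have lims: "limitin M.mtopology s (fst l) sequentially"
        "limitin M.mtopology (\<lambda>n. A (s n)) (snd l) sequentially"
        using * by (simp_all add: mtopology_prod_metric limitin_pairwise flip: s_def sndf)
      have sX: "s n \<in> X" and AsX: "A (s n) \<in> X" for n
        using sV VX AV PX by blast+
      have "range s \<subseteq> X" "range (\<lambda>n. A (s n)) \<subseteq> X"
        using sX AsX by blast+
      note lim1 = lims(1)[unfolded limitin_ip_iff[OF this(1)]]
       and lim2 = lims(2)[unfolded limitin_ip_iff[OF this(2)]]
      have "snd l \<in> P"
        by (rule closedin_limit[OF P_closed _ lims(2)]) (use AV[OF sV] in blast)
      define d where "d = (\<lambda>n. s n - R (A (s n)))"
      have Rl: "R (snd l) \<in> X" and RA: "R (A (s n)) \<in> X" for n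
        using RX lim2 AsX by blast+
      have "nrm (d n - (fst l - R (snd l))) \<le> nrm (s n - fst l) + B * nrm (A (s n) - snd l)" for n
      proof -
        have eq: "d n - (fst l - R (snd l)) = (s n - fst l) - R (A (s n) - snd l)"
          using operator_on_diff[OF R, of "A (s n)" "snd l"] AsX lim2
          by (simp add: d_def algebra_simps)
        have "nrm ((s n - fst l) - R (A (s n) - snd l))
            \<le> nrm (s n - fst l) + nrm (R (A (s n) - snd l))"
          using sX AsX lim1 lim2 RX[of "A (s n) - snd l"] by (intro nrm_diff_triangle) auto
        moreover have "nrm (R (A (s n) - snd l)) \<le> B * nrm (A (s n) - snd l)"
          using AsX lim2 by (intro R_bound) auto
        ultimately show ?thesis
          unfolding eq by linarith
      qed
      then have "\<forall>\<^sub>F n in sequentially. norm (nrm (d n - (fst l - R (snd l))))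
          \<le> nrm (s n - fst l) + B * nrm (A (s n) - snd l)"
        by (intro always_eventually) simp
      moreover have "(\<lambda>n. nrm (s n - fst l) + B * nrm (A (s n) - snd l)) \<longlonglongrightarrow> 0"
        by (intro tendsto_add_zero tendsto_mult_right_zero conjunct2[OF lim1] conjunct2[OF lim2])
      ultimately have "(\<lambda>n. nrm (d n - (fst l - R (snd l)))) \<longlonglongrightarrow> 0"
        by (rule Lim_null_comparison)
      moreover have "range d \<subseteq> cmat.span E"
        using AV[OF sV] by (auto simp: d_def)
      moreover have "range d \<subseteq> X"
        using sX RA by (auto simp: d_def)
      ultimately have "limitin M.mtopology d (fst l - R (snd l)) sequentially"
        using limitin_ip_iff[of d] diff_mem[OF conjunct1[OF lim1] Rl] by blast
      then have "fst l - R (snd l) \<in> cmat.span E"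
        by (rule closedin_limit[OF closedin_span[OF E] \<open>range d \<subseteq> cmat.span E\<close>])
      then have "fst l \<in> V" "A (fst l) = snd l"
        using VI[OF _ \<open>snd l \<in> P\<close>, of "fst l - R (snd l)"] A[OF _ \<open>snd l \<in> P\<close>, of "fst l - R (snd l)"]
        by simp_all
      then show "l \<in> (\<lambda>a. (a, A a)) ` V"
        by (intro image_eqI[of _ _ "fst l"]) (auto simp: prod_eq_iff)
    qed
    then show ?thesis
      by (simp add: closed_operator_def ip_topology_eq mtopology_prod_metric)
  qed
  moreover have "fin_dim (cmat.span E)" "fin_dim (cmat.span C)"
    using E C by (auto simp: fin_dim_def orth_family_def)
  ultimately show "fredholm X ip V A"
    using opA dense P_closed by (simp add: fredholm_def ker coker range ip_topology_eq)
  show "fredholm_index X ip V A = int (card E) - int (card C)"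
    unfolding fredholm_index_def ker coker dim_span_orth_family[OF E] dim_span_orth_family[OF C] ..

  define res where "res F a = a - proj F a" for F and a :: cmat
  define Q where "Q a = res E (R (res C a))" for a :: cmat
  have res_op: "operator_on X X (res F)" if "orth_family F" for F
  proof -
    have "res F = (\<lambda>a. a - proj F a)"
      by (rule ext) (rule res_def)
    then show ?thesis
      using operator_on_residual[OF that] by simp
  qed
  have resX: "res F a \<in> X" if "orth_family F" "a \<in> X" for F a
    using proj_mem[OF that(1)] that(2) by (simp add: res_def)
  have res_le: "nrm (res F a) \<le> nrm a" if "orth_family F" "a \<in> X" for F a
    using nrm_residual_le[OF that] by (simp add: res_def)
  have resP: "res C a \<in> P" if "a \<in> X" for a
    unfolding P_def orth_complement_def res_def
    using ip_residual[OF C that] diff_mem[OF that proj_mem[OF C]] by blast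
  have "Q = (\<lambda>a. res E (R (res C a)))"
    by (rule ext) (rule Q_def)
  then have opQ: "operator_on X X Q"
    using operator_on_compose[OF res_op[OF E] operator_on_compose[OF R res_op[OF C]]] by simp
  have Q_bound: "nrm (Q a) \<le> \<bar>B\<bar> * nrm a" if a: "a \<in> X" for a
  proof -
    have "nrm (Q a) \<le> nrm (R (res C a))"
      unfolding Q_def using a by (intro res_le E RX resX C)
    also have "\<dots> \<le> B * nrm (res C a)"
      by (intro R_bound resX C a)
    also have "\<dots> \<le> \<bar>B\<bar> * nrm (res C a)"
      by (intro mult_right_mono) auto
    also have "\<dots> \<le> \<bar>B\<bar> * nrm a"
      by (intro mult_left_mono res_le C a) auto
    finally show ?thesis .
  qed
  have Q_eq: "Q a = - proj E (R (res C a)) + R (res C a)" for a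
    by (simp add: Q_def res_def)
  have QV: "Q a \<in> V" and AQ: "A (Q a) = res C a" if "a \<in> X" for a
    unfolding Q_eq using resP[OF that]
    by (intro VI A cmat.span_neg proj_span; assumption)+
  have QA: "Q (A a) = res E a" if a: "a \<in> V" for a
  proof -
    have "res C (A a) = A a"
      using AV[OF a] proj_of_orth[of C "A a"] unfolding res_def P_def orth_complement_def by simp
    then have "Q (A a) = res E (a - (a - R (A a)))"
      by (simp add: Q_def)
    also have "\<dots> = res E a - res E (a - R (A a))"
      by (rule operator_on_diff[OF res_op[OF E]]) (use AV[OF a] a VX EX in blast)+
    also have "res E (a - R (A a)) = 0"
      using proj_of_span[OF E, of "a - R (A a)"] AV[OF a] unfolding res_def by simp
    finally show ?thesis
      by simp
  qed
  have kerQ: "op_kernel X Q = cmat.span C"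
  proof (intro equalityI subsetI)
    fix a assume "a \<in> op_kernel X Q"
    then have a: "a \<in> X" and "Q a = 0"
      by (auto simp: op_kernel_def)
    then have "res C a = A 0"
      using AQ[OF a] by simp
    also have "A 0 = 0"
      using A[OF cmat.span_zero cmat.subspace_0[OF P_sub]] R0 by simp
    finally have "proj C a = a"
      by (simp add: res_def)
    then show "a \<in> cmat.span C"
      using proj_span[of C a] by simp
  next
    fix a assume a: "a \<in> cmat.span C"
    then have "res C a = 0"
      using proj_of_span[OF C a] by (simp add: res_def)
    then show "a \<in> op_kernel X Q"
      using span_mem[OF C a] R0 operator_on_zero[OF res_op[OF E]] by (simp add: op_kernel_def Q_def)
  qed
  \<comment> \<open>The continuous image of \<open>T\<close> under the outer projection is compact, hence closed,
    and contains the image of the ball.\<close>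
  have "compactin M.mtopology (M.mtopology closure_of (Q ` {a \<in> X. nrm a \<le> 1}))"
  proof -
    have cpt: "compactin M.mtopology (res E ` T)"
      using res_le[OF E]
      by (intro image_compactin[OF T] continuous_map_of_bounded[where B = 1] res_op E) auto
    have "Q ` {a \<in> X. nrm a \<le> 1} \<subseteq> res E ` T"
    proof
      fix q assume "q \<in> Q ` {a \<in> X. nrm a \<le> 1}"
      then obtain a where a: "a \<in> X" "nrm a \<le> 1" and q: "q = res E (R (res C a))"
        by (auto simp: Q_def)
      have "nrm (res C a) \<le> 1"
        using res_le[OF C a(1)] a(2) by linarith
      then show "q \<in> res E ` T"
        using R_ball resX[OF C a(1)] q by blast
    qed
    moreover have "closedin M.mtopology (res E ` T)"
      using cpt M.Hausdorff_space_mtopology by (intro compactin_imp_closedin)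
    ultimately have "M.mtopology closure_of (Q ` {a \<in> X. nrm a \<le> 1}) \<subseteq> res E ` T"
      by (rule closure_of_minimal)
    then show ?thesis
      by (rule closed_compactin[OF cpt]) (rule closedin_closure_of)
  qed
  then show "\<exists>Q. bounded_operator X ip Q \<and>
      op_kernel X Q = op_coker X ip V A \<and>
      (\<forall>a\<in>X. Q a \<in> V \<and> A (Q a) = a - orth_proj ip (op_coker X ip V A) a) \<and>
      (\<forall>a\<in>V. Q (A a) = a - orth_proj ip (op_kernel V A) a) \<and>
      compact_operator X ip Q"
  proof (intro exI[of _ Q] conjI ballI)
    show "bounded_operator X ip Q"
      unfolding bounded_operator_def using opQ Q_bound by blast
    show "op_kernel X Q = op_coker X ip V A"
      unfolding kerQ coker ..
    show "Q a \<in> V" "A (Q a) = a - orth_proj ip (op_coker X ip V A) a" if "a \<in> X" for a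
      using QV[OF that] AQ[OF that] unfolding coker orth_proj_span[OF C that] res_def by blast+
    show "Q (A a) = a - orth_proj ip (op_kernel V A) a" if "a \<in> V" for a
      using QA[OF that] VX that unfolding ker orth_proj_span[OF E subsetD[OF VX that]] res_def by blast
    assume "compactin M.mtopology (M.mtopology closure_of (Q ` {a \<in> X. nrm a \<le> 1}))"
    then show "compact_operator X ip Q"
      unfolding compact_operator_def ip_topology_eq using opQ by blast
  qed
qed

end

section \<open>The weighted Hilbert space of matrices\<close>

lemma Cauchy_Schwarz_infsum:
  fixes f g :: "'a \<Rightarrow> real"
  assumes f: "(\<lambda>x. (f x)\<^sup>2) summable_on A" and g: "(\<lambda>x. (g x)\<^sup>2) summable_on A"
  shows "(\<lambda>x. \<bar>f x * g x\<bar>) summable_on A"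
    and "(\<Sum>\<^sub>\<infinity>x\<in>A. \<bar>f x * g x\<bar>)
      \<le> sqrt (\<Sum>\<^sub>\<infinity>x\<in>A. (f x)\<^sup>2) * sqrt (\<Sum>\<^sub>\<infinity>x\<in>A. (g x)\<^sup>2)"
proof -
  let ?B = "sqrt (\<Sum>\<^sub>\<infinity>x\<in>A. (f x)\<^sup>2) * sqrt (\<Sum>\<^sub>\<infinity>x\<in>A. (g x)\<^sup>2)"
  have fin: "(\<Sum>x\<in>F. \<bar>f x * g x\<bar>) \<le> ?B" if F: "finite F" "F \<subseteq> A" for F
  proof -
    have "(\<Sum>x\<in>F. \<bar>f x * g x\<bar>) \<le> L2_set f F * L2_set g F"
      using L2_set_mult_ineq[of f g F] by (simp add: abs_mult)
    also have "\<dots> \<le> ?B"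
      unfolding L2_set_def using F f g
      by (intro mult_mono real_sqrt_le_mono finite_sum_le_infsum) (auto intro: sum_nonneg infsum_nonneg)
    finally show ?thesis .
  qed
  show s: "(\<lambda>x. \<bar>f x * g x\<bar>) summable_on A"
    by (rule nonneg_bdd_above_summable_on) (auto intro!: bdd_aboveI2[where M = ?B] fin)
  show "(\<Sum>\<^sub>\<infinity>x\<in>A. \<bar>f x * g x\<bar>) \<le> ?B"
    by (rule infsum_le_finite_sums[OF s fin])
qed

lemma infsum_complex_of_real:
  "(\<Sum>\<^sub>\<infinity>x\<in>A. complex_of_real (f x)) = complex_of_real (infsum f A)"
proof (cases "f summable_on A")
  case True
  then show ?thesis
    by (intro infsumI) (simp add: has_sum_of_real_iff)
next
  case False
  then have "\<not> (\<lambda>x. complex_of_real (f x)) summable_on A"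
    using summable_on_Re[of "\<lambda>x. complex_of_real (f x)" A] by auto
  then show ?thesis
    using False by (simp add: infsum_not_exists)
qed

text \<open>
  Matrices are summed over index pairs, so that unordered summation over subsets of \<open>\<nat> \<times> \<nat>\<close>, such as
  diagonals, applies to them.
\<close>

definition entry :: "cmat \<Rightarrow> nat \<times> nat \<Rightarrow> complex"
  where "entry a x = a (fst x) (snd x)"

lemma entry_simps [simp]:
  "entry (a + b) x = entry a x + entry b x"
  "entry (a - b) x = entry a x - entry b x"
  "entry (- a) x = - entry a x"
  "entry 0 x = 0"
  "entry (mscale z a) x = z * entry a x"
  by (simp_all add: entry_def mscale_def)

lemma entry_eqI: "(\<And>x. entry a x = entry b x) \<Longrightarrow> a = b"
  by (auto simp: entry_def fun_eq_iff)

locale positive_weights =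
  fixes w :: "nat \<Rightarrow> real"
  assumes s_pos: "0 < s_seq w k"
begin

definition wt :: "nat \<times> nat \<Rightarrow> real"
  where "wt x = sqrt (s_seq w (fst x)) * sqrt (s_seq w (snd x))"

lemma wt_pos [simp]: "0 < wt x"
  using s_pos by (simp add: wt_def)

lemma wt_nonneg [simp]: "0 \<le> wt x"
  using wt_pos[of x] by linarith

definition energy :: "cmat \<Rightarrow> nat \<times> nat \<Rightarrow> real"
  where "energy a x = wt x * (cmod (entry a x))\<^sup>2"

lemma energy_nonneg [simp]: "0 \<le> energy a x"
  by (simp add: energy_def)

lemma energy_mscale: "energy (mscale z a) x = (cmod z)\<^sup>2 * energy a x"
  by (simp add: energy_def norm_mult power_mult_distrib)

lemma energy_sqrt: "(sqrt (wt x) * cmod (entry a x))\<^sup>2 = energy a x"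
  by (simp add: energy_def power_mult_distrib)

lemma energy_diff_le: "energy (a - b) x \<le> 2 * energy a x + 2 * energy b x"
proof -
  have "(cmod (entry a x - entry b x))\<^sup>2 \<le> (cmod (entry a x) + cmod (entry b x))\<^sup>2"
    by (intro power_mono norm_triangle_ineq4) simp
  also have "\<dots> \<le> 2 * (cmod (entry a x))\<^sup>2 + 2 * (cmod (entry b x))\<^sup>2"
    using sum_squares_bound[of "cmod (entry a x)" "cmod (entry b x)"] by (simp add: power2_sum)
  finally have "wt x * (cmod (entry a x - entry b x))\<^sup>2
      \<le> wt x * (2 * (cmod (entry a x))\<^sup>2 + 2 * (cmod (entry b x))\<^sup>2)"
    by (intro mult_left_mono) simp_all
  then show ?thesis
    by (simp add: energy_def algebra_simps)
qed

lemma nc_space_iff: "a \<in> nc_space w \<longleftrightarrow> energy a summable_on UNIV"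
proof -
  have "energy a = (\<lambda>(i, j). sqrt (s_seq w i) * sqrt (s_seq w j) * (cmod (a i j))\<^sup>2)"
    by (auto simp: fun_eq_iff energy_def wt_def entry_def)
  then show ?thesis
    by (simp add: nc_space_def)
qed

lemma nc_spaceI:
  assumes "\<And>F. finite F \<Longrightarrow> sum (energy a) F \<le> B"
  shows "a \<in> nc_space w"
  unfolding nc_space_iff
  by (rule nonneg_bdd_above_summable_on) (auto intro!: bdd_aboveI2[where M = B] assms)

lemma nc_space_subspace: "cmat.subspace (nc_space w)"
proof (rule cmat.subspaceI)
  show "0 \<in> nc_space w"
    by (rule nc_spaceI[of _ 0]) (simp add: energy_def)
next
  fix a b assume ab: "a \<in> nc_space w" "b \<in> nc_space w"
  have le: "energy (a + b) x \<le> 2 * energy a x + 2 * energy b x" for x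
    using energy_diff_le[of a "- b" x] by (simp add: energy_def)
  have "(\<lambda>x. 2 * energy a x + 2 * energy b x) summable_on UNIV"
    using ab by (intro summable_on_add summable_on_cmult_right) (simp_all add: nc_space_iff)
  then show "a + b \<in> nc_space w"
    unfolding nc_space_iff by (rule summable_on_comparison_test) (simp_all add: le)
next
  fix z a assume "a \<in> nc_space w"
  then show "mscale z a \<in> nc_space w"
    unfolding nc_space_iff energy_mscale[abs_def] by (rule summable_on_cmult_right)
qed

lemma ip_summand_summable:
  assumes "a \<in> nc_space w" "b \<in> nc_space w"
  shows "(\<lambda>x. complex_of_real (wt x) * (entry b x * cnj (entry a x))) summable_on UNIV"
proof -
  have *: "(\<lambda>x. (sqrt (wt x) * cmod (entry c x))\<^sup>2) summable_on UNIV" if "c \<in> nc_space w" for c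
    using that by (simp add: energy_sqrt nc_space_iff)
  have sq: "\<bar>(sqrt (wt x) * p) * (sqrt (wt x) * q)\<bar> = wt x * (p * q)" if "0 \<le> p" "0 \<le> q" for x p q
  proof -
    have "(sqrt (wt x) * p) * (sqrt (wt x) * q) = (sqrt (wt x) * sqrt (wt x)) * (p * q)"
      by (simp only: mult_ac)
    also have "sqrt (wt x) * sqrt (wt x) = wt x"
      by (rule real_sqrt_mult_self[of "wt x", unfolded abs_of_nonneg[OF wt_nonneg]])
    finally show ?thesis
      using that by simp
  qed
  have "norm (complex_of_real (wt x) * (entry b x * cnj (entry a x)))
      = \<bar>(sqrt (wt x) * cmod (entry b x)) * (sqrt (wt x) * cmod (entry a x))\<bar>" for x
    unfolding sq[OF norm_ge_zero norm_ge_zero] by (simp add: norm_mult)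
  then show ?thesis
    by (intro abs_summable_summable[OF summable_on_cong[THEN iffD2,
          OF _ Cauchy_Schwarz_infsum(1)[OF *[OF assms(2)] *[OF assms(1)]]]])
qed

lemma nc_inner_infsum:
  assumes "a \<in> nc_space w" "b \<in> nc_space w"
  shows "nc_inner w a b = (\<Sum>\<^sub>\<infinity>x. complex_of_real (wt x) * (entry b x * cnj (entry a x)))"
proof -
  let ?f = "\<lambda>x. complex_of_real (wt x) * (entry b x * cnj (entry a x))"
  have "?f summable_on UNIV \<times> UNIV"
    using ip_summand_summable[OF assms] by simp
  then have "(\<Sum>\<^sub>\<infinity>i. \<Sum>\<^sub>\<infinity>j. ?f (i, j)) = infsum ?f (UNIV \<times> UNIV)"
    by (rule infsum_Sigma_banach)
  then show ?thesis
    by (simp add: nc_inner_eq wt_def entry_def)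
qed

lemma nc_inner_self: "nc_inner w a a = complex_of_real (\<Sum>\<^sub>\<infinity>i. \<Sum>\<^sub>\<infinity>j. energy a (i, j))"
proof -
  have "complex_of_real (sqrt (s_seq w i) * sqrt (s_seq w j)) * (a i j * cnj (a i j))
      = complex_of_real (energy a (i, j))" for i j
    by (simp add: energy_def wt_def entry_def complex_norm_square del: of_real_power)
  then show ?thesis
    by (simp add: nc_inner_eq infsum_complex_of_real)
qed

lemma Re_nc_inner_self:
  assumes "a \<in> nc_space w"
  shows "Re (nc_inner w a a) = infsum (energy a) UNIV"
proof -
  have "energy a summable_on UNIV \<times> UNIV"
    using assms by (simp add: nc_space_iff)
  then have "(\<Sum>\<^sub>\<infinity>i. \<Sum>\<^sub>\<infinity>j. energy a (i, j)) = infsum (energy a) (UNIV \<times> UNIV)"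
    by (rule infsum_Sigma_banach)
  then show ?thesis
    by (simp add: nc_inner_self)
qed

sublocale H: ip_space "nc_space w" "nc_inner w"
proof
  show "cmat.subspace (nc_space w)"
    by (rule nc_space_subspace)
next
  fix a b c assume a: "a \<in> nc_space w" and b: "b \<in> nc_space w" and c: "c \<in> nc_space w"
  note s = ip_summand_summable
  have "b + c \<in> nc_space w"
    using b c by (rule cmat.subspace_add[OF nc_space_subspace])
  then show "nc_inner w a (b + c) = nc_inner w a b + nc_inner w a c"
    using infsum_add[OF s[OF a b] s[OF a c]] a b c by (simp add: nc_inner_infsum algebra_simps)
next
  fix a b z assume a: "a \<in> nc_space w" and b: "b \<in> nc_space w"
  have zb: "mscale z b \<in> nc_space w"
    using b by (rule cmat.subspace_scale[OF nc_space_subspace])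
  show "nc_inner w a (mscale z b) = z * nc_inner w a b"
    unfolding nc_inner_infsum[OF a zb] nc_inner_infsum[OF a b] infsum_cmult_right'[symmetric]
    by (intro infsum_cong) (simp add: mult_ac)
next
  fix a b assume a: "a \<in> nc_space w" and b: "b \<in> nc_space w"
  have "complex_of_real (wt x) * (entry a x * cnj (entry b x))
      = cnj (complex_of_real (wt x) * (entry b x * cnj (entry a x)))" for x
    by simp
  then show "nc_inner w b a = cnj (nc_inner w a b)"
    unfolding nc_inner_infsum[OF a b] nc_inner_infsum[OF b a] infsum_cnj[symmetric]
    by (intro infsum_cong)
next
  fix a assume a: "a \<in> nc_space w" and nz: "a \<noteq> 0"
  obtain x where "entry a x \<noteq> 0"
    using nz entry_eqI[of a 0] by auto
  then have "0 < energy a x"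
    by (simp add: energy_def)
  also have "energy a x = sum (energy a) {x}"
    by simp
  also have "\<dots> \<le> infsum (energy a) UNIV"
    using a by (intro finite_sum_le_infsum) (simp_all add: nc_space_iff)
  finally show "0 < Re (nc_inner w a a)"
    by (simp add: Re_nc_inner_self a)
next
  fix a
  show "0 \<le> Re (nc_inner w a a)"
    by (simp add: nc_inner_self infsum_nonneg)
  show "nc_inner w (- a) (- a) = nc_inner w a a"
    by (simp add: nc_inner_eq)
qed

abbreviation nrm :: "cmat \<Rightarrow> real"
  where "nrm \<equiv> ip_norm (nc_inner w)"

lemma nrm_sq_infsum: "a \<in> nc_space w \<Longrightarrow> (nrm a)\<^sup>2 = infsum (energy a) UNIV"
  by (simp add: H.nrm_sq Re_nc_inner_self)

lemma nrm_sq_leI: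
  assumes "\<And>F. finite F \<Longrightarrow> sum (energy a) F \<le> B"
  shows "a \<in> nc_space w" "(nrm a)\<^sup>2 \<le> B"
proof -
  show a: "a \<in> nc_space w"
    by (rule nc_spaceI[OF assms])
  then show "(nrm a)\<^sup>2 \<le> B"
    unfolding nrm_sq_infsum[OF a] by (intro infsum_le_finite_sums assms) (simp add: nc_space_iff)
qed

text \<open>
  Truncation to a large finite set of entries approximates in norm.
\<close>

lemma densely_definedI:
  assumes V: "V \<subseteq> nc_space w"
    and fin: "\<And>a. finite {x. entry a x \<noteq> 0} \<Longrightarrow> a \<in> V"
  shows "densely_defined (nc_space w) (nc_inner w) V"
proof -
  have "\<exists>b\<in>V. b \<in> H.M.mball a e" if a: "a \<in> nc_space w" and e: "0 < e" for a e
  proof -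
    have s: "energy a summable_on UNIV"
      using a by (simp add: nc_space_iff)
    have "0 < (e / 2)\<^sup>2"
      using e by simp
    then obtain F where F: "finite F" and close: "dist (sum (energy a) F) (infsum (energy a) UNIV) \<le> (e / 2)\<^sup>2"
      using infsum_finite_approximation[OF s] by blast
    define b where "b = (\<lambda>i j. if (i, j) \<in> F then a i j else 0)"
    have entry_b: "entry b x = (if x \<in> F then entry a x else 0)" for x
      by (simp add: entry_def b_def)
    have "{x. entry b x \<noteq> 0} \<subseteq> F"
      by (auto simp: entry_b)
    then have b: "b \<in> V"
      using F by (intro fin) (rule finite_subset)
    have "sum (energy (a - b)) G \<le> (e / 2)\<^sup>2" if G: "finite G" for G
    proof -
      have "sum (energy (a - b)) G = sum (energy a) (G - F)"
        using G by (intro sum.mono_neutral_cong_right) (auto simp: energy_def entry_b)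
      also have "\<dots> = sum (energy a) (G \<union> F) - sum (energy a) F"
        using F G by (subst sum_diff[symmetric]) (auto intro: sum.cong)
      also have "sum (energy a) (G \<union> F) \<le> infsum (energy a) UNIV"
        using F G s by (intro finite_sum_le_infsum) auto
      finally show ?thesis
        using close by (simp add: dist_real_def abs_le_iff)
    qed
    then have "(nrm (a - b))\<^sup>2 \<le> (e / 2)\<^sup>2"
      by (rule nrm_sq_leI)
    then have "nrm (a - b) \<le> e / 2"
      by (rule power2_le_imp_le) (use e in simp)
    then have "b \<in> H.M.mball a e"
      using a b V e by auto
    then show ?thesis
      using b by blast
  qed
  then have "H.M.mtopology closure_of V = nc_space w"
    unfolding H.M.metric_closure_of by blast
  then show ?thesis
    by (simp add: densely_defined_def H.ip_topology_eq)
qed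

text \<open>
  A Kolmogorov-Riesz criterion.  A bounded sequence of matrices has a subsequence that converges
  entrywise, by Tychonoff's theorem; if the energies outside a finite set are uniformly small, the
  convergence is in norm.  All conditions are put on finite partial sums, so that they pass to the
  entrywise limit and the set itself, not only its closure, is compact.
\<close>

lemma compactin_uniform_tails:
  fixes F :: "nat \<Rightarrow> (nat \<times> nat) set"
  assumes fin: "\<And>m. finite (F m)" and r: "r \<longlonglongrightarrow> 0"
  shows "compactin H.M.mtopology
    {a. (\<forall>G. finite G \<longrightarrow> sum (energy a) G \<le> B) \<and>
        (\<forall>m G. finite G \<longrightarrow> G \<inter> F m = {} \<longrightarrow> sum (energy a) G \<le> r m)}"
    (is "compactin _ ?T")
  unfolding H.M.compactin_sequentially
proof (intro conjI allI impI)
  show T_sub: "?T \<subseteq> nc_space w"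
    using nc_spaceI by blast
  fix \<sigma> :: "nat \<Rightarrow> cmat"
  assume \<sigma>: "range \<sigma> \<subseteq> ?T"
  have \<sigma>B: "sum (energy (\<sigma> n)) G \<le> B" if "finite G" for n G
    using \<sigma> that by blast
  have \<sigma>r: "sum (energy (\<sigma> n)) G \<le> r m" if "finite G" "G \<inter> F m = {}" for n m G
    using \<sigma> that by blast
  have bound: "entry (\<sigma> n) x \<in> cball 0 (sqrt (B / wt x))" for n x
  proof -
    have "wt x * (cmod (entry (\<sigma> n) x))\<^sup>2 \<le> B"
      using \<sigma>B[of "{x}" n] by (simp add: energy_def)
    then have "(cmod (entry (\<sigma> n) x))\<^sup>2 \<le> B / wt x"
      by (simp add: pos_le_divide_eq mult.commute)
    then show ?thesis
      by (simp add: real_le_rsqrt)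
  qed
  define K :: "(nat \<times> nat \<Rightarrow> complex) set"
    where "K = (\<Pi>\<^sub>E x\<in>UNIV. cball 0 (sqrt (B / wt x)))"
  have "compactin (product_topology (\<lambda>_. euclidean) UNIV) K"
    unfolding K_def compactin_PiE by (simp add: compactin_euclidean_iff)
  then have "compact K"
    by (simp add: euclidean_product_topology)
  then have "seq_compact K"
    by (rule compact_imp_seq_compact)
  moreover have "entry (\<sigma> n) \<in> K" for n
    unfolding K_def using bound by blast
  ultimately obtain f \<rho> where \<rho>: "strict_mono (\<rho> :: nat \<Rightarrow> nat)"
      and lim: "((\<lambda>n. entry (\<sigma> n)) \<circ> \<rho>) \<longlonglongrightarrow> f"
    unfolding seq_compact_def by meson
  have pt: "(\<lambda>n. entry (\<sigma> (\<rho> n)) x) \<longlonglongrightarrow> f x" for x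
    using continuous_on_tendsto_compose[OF continuous_on_product_coordinates[of x] lim]
    by (simp add: o_def)
  define l :: cmat where "l = (\<lambda>i j. f (i, j))"
  have entry_l: "entry l x = f x" for x
    by (simp add: l_def entry_def)
  have sum_lim: "(\<lambda>n. sum (energy (\<sigma> (\<rho> n))) G) \<longlonglongrightarrow> sum (energy l) G" for G
    unfolding energy_def entry_l by (intro tendsto_intros pt)
  have lB: "sum (energy l) G \<le> B" if "finite G" for G
    using \<sigma>B[OF that] by (intro LIMSEQ_le_const2[OF sum_lim]) blast
  have lr: "sum (energy l) G \<le> r m" if "finite G" "G \<inter> F m = {}" for G m
    using \<sigma>r[OF that] by (intro LIMSEQ_le_const2[OF sum_lim]) blast
  have "l \<in> ?T"
    using lB lr by blast
  moreover have "limitin H.M.mtopology (\<sigma> \<circ> \<rho>) l sequentially"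
  proof -
    have rng: "range (\<sigma> \<circ> \<rho>) \<subseteq> nc_space w"
      using nc_spaceI[OF \<sigma>B] by (simp add: image_subset_iff)
    have l: "l \<in> nc_space w"
      using lB by (rule nc_spaceI)
    have near: "(nrm (\<sigma> (\<rho> n) - l))\<^sup>2 \<le> sum (energy (\<sigma> (\<rho> n) - l)) (F m) + 4 * r m" for n m
    proof (rule nrm_sq_leI)
      fix G :: "(nat \<times> nat) set" assume G: "finite G"
      define d where "d = energy (\<sigma> (\<rho> n) - l)"
      have "sum d G
          = sum d (G \<inter> F m) + sum d (G - F m)"
        by (rule sum.Int_Diff[OF G])
      also have "sum d (G \<inter> F m) \<le> sum d (F m)"
        using fin by (intro sum_mono2) (auto simp: d_def)
      also have "sum d (G - F m)
          \<le> (\<Sum>x\<in>G - F m. 2 * energy (\<sigma> (\<rho> n)) x + 2 * energy l x)"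
        unfolding d_def by (intro sum_mono energy_diff_le)
      also have "\<dots> = 2 * sum (energy (\<sigma> (\<rho> n))) (G - F m) + 2 * sum (energy l) (G - F m)"
        by (simp add: sum.distrib sum_distrib_left)
      also have "\<dots> \<le> 2 * r m + 2 * r m"
        using G by (intro add_mono mult_left_mono \<sigma>r lr) auto
      finally have "sum d G \<le> sum d (F m) + 4 * r m"
        by simp
      then show "sum (energy (\<sigma> (\<rho> n) - l)) G \<le> sum (energy (\<sigma> (\<rho> n) - l)) (F m) + 4 * r m"
        unfolding d_def .
    qed
    have "(\<lambda>n. (nrm (\<sigma> (\<rho> n) - l))\<^sup>2) \<longlonglongrightarrow> 0"
    proof (rule LIMSEQ_I)
      fix e :: real assume e: "0 < e"
      then obtain m where m: "\<bar>r m\<bar> < e / 8"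
        using LIMSEQ_D[OF r, of "e / 8"] by auto
      have "(\<lambda>n. sum (energy (\<sigma> (\<rho> n) - l)) (F m))
          \<longlonglongrightarrow> (\<Sum>x\<in>F m. wt x * (cmod (f x - f x))\<^sup>2)"
        unfolding energy_def entry_simps entry_l by (intro tendsto_intros pt)
      then have "(\<lambda>n. sum (energy (\<sigma> (\<rho> n) - l)) (F m)) \<longlonglongrightarrow> 0"
        by simp
      then obtain n0 where n0: "\<And>n. n0 \<le> n \<Longrightarrow> norm (sum (energy (\<sigma> (\<rho> n) - l)) (F m)) < e / 2"
        using LIMSEQ_D[of _ 0 "e / 2"] e by force
      show "\<exists>n0. \<forall>n\<ge>n0. norm ((nrm (\<sigma> (\<rho> n) - l))\<^sup>2 - 0) < e"
      proof (intro exI allI impI)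
        fix n assume "n0 \<le> n"
        then have "sum (energy (\<sigma> (\<rho> n) - l)) (F m) < e / 2"
          using n0[of n] by simp
        then show "norm ((nrm (\<sigma> (\<rho> n) - l))\<^sup>2 - 0) < e"
          using near[of n m] m by simp
      qed
    qed
    then have "(\<lambda>n. sqrt ((nrm (\<sigma> (\<rho> n) - l))\<^sup>2)) \<longlonglongrightarrow> sqrt 0"
      by (rule tendsto_real_sqrt)
    then have "(\<lambda>n. nrm ((\<sigma> \<circ> \<rho>) n - l)) \<longlonglongrightarrow> 0"
      by simp
    then show ?thesis
      unfolding H.limitin_ip_iff[OF rng] using l by blast
  qed
  ultimately show "\<exists>l \<rho>. l \<in> ?T \<and> strict_mono \<rho> \<and> limitin H.M.mtopology (\<sigma> \<circ> \<rho>) l sequentially"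
    using \<rho> by blast
qed

end

section \<open>Integration along the diagonals\<close>

lemma summable_on_tail:
  fixes f :: "'a \<Rightarrow> real"
  assumes f: "f summable_on A" and nonneg: "\<And>x. x \<in> A \<Longrightarrow> 0 \<le> f x" and e: "0 < e"
  shows "\<exists>F. finite F \<and> (\<forall>G. finite G \<longrightarrow> G \<subseteq> A \<longrightarrow> G \<inter> F = {} \<longrightarrow> sum f G \<le> e)"
proof -
  obtain F where F: "finite F" "F \<subseteq> A" "dist (sum f F) (infsum f A) \<le> e"
    using infsum_finite_approximation[OF f e] by blast
  have "sum f G \<le> e" if "finite G" "G \<subseteq> A" "G \<inter> F = {}" for G
  proof -
    have "sum f G + sum f F = sum f (G \<union> F)"
      using that F by (intro sum.union_disjoint[symmetric])
    also have "\<dots> \<le> infsum f A"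
      using that F f nonneg by (intro finite_sum_le_infsum) auto
    finally show ?thesis
      using F(3) by (simp add: dist_real_def abs_le_iff)
  qed
  then show ?thesis
    using F(1) by blast
qed

definition offset :: "nat \<times> nat \<Rightarrow> int"
  where "offset x = int (fst x) - int (snd x)"

abbreviation diagonal :: "int \<Rightarrow> (nat \<times> nat) set"
  where "diagonal d \<equiv> {x. offset x = d}"

lemma inj_on_diagonal: "inj_on fst (diagonal d)" "inj_on snd (diagonal d)"
  by (auto simp: inj_on_def offset_def)

locale nc_disk = positive_weights +
  fixes \<epsilon> :: real
  assumes eps_pos: "0 < \<epsilon>" and w_ge: "\<epsilon> \<le> w k" and w_bounded: "bounded (range w)"
begin

lemma w_pos [simp]: "0 < w k"
  using eps_pos w_ge[of k] by linarith

lemma w_nonneg [simp]: "0 \<le> w k"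
  by (rule less_imp_le[OF w_pos])

lemma w_nonzero [simp]: "w k \<noteq> 0"
  using w_pos[of k] by linarith

lemma w_mono: "incseq w"
proof (rule incseq_SucI)
  fix k
  have "0 < (w (Suc k))\<^sup>2 - (w k)\<^sup>2"
    using s_pos[of "Suc k"] by (simp only: s_seq_def diff_Suc_1 nat.distinct if_False)
  then have "(w k)\<^sup>2 \<le> (w (Suc k))\<^sup>2"
    by linarith
  then show "w k \<le> w (Suc k)"
    by (rule power2_le_imp_le) simp
qed

lemma w_limit: obtains l where "0 < l" "w \<longlonglongrightarrow> l"
proof -
  obtain K where "\<And>k. \<bar>w k\<bar> \<le> K"
    using w_bounded by (auto simp: bounded_iff)
  then have "w k \<le> K" for k
    using abs_le_D1 by blast
  then obtain l where l: "w \<longlonglongrightarrow> l"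
    using incseq_convergent[OF w_mono] by blast
  moreover have "\<epsilon> \<le> l"
    using w_ge by (intro LIMSEQ_le_const[OF l]) blast
  ultimately show ?thesis
    using that[of l] eps_pos by simp
qed

lemma s_nonneg [simp]: "0 \<le> s_seq w k"
  by (rule less_imp_le[OF s_pos])

lemma s_summable: "s_seq w summable_on UNIV"
proof -
  obtain K where K: "\<And>k. \<bar>w k\<bar> \<le> K"
    using w_bounded by (auto simp: bounded_iff)
  have partial: "sum (s_seq w) {..n} = (w n)\<^sup>2" for n
    by (induction n) (simp_all add: s_seq_def)
  have "sum (s_seq w) F \<le> K\<^sup>2" if F: "finite F" for F
  proof -
    obtain n where "F \<subseteq> {..n}"
      using F finite_nat_iff_bounded_le by blast
    then have "sum (s_seq w) F \<le> sum (s_seq w) {..n}"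
      using s_pos by (intro sum_mono2) auto
    also have "\<dots> \<le> K\<^sup>2"
      unfolding partial using K[of n] by (simp add: abs_le_square_iff[symmetric])
    finally show ?thesis .
  qed
  then show ?thesis
    by (intro nonneg_bdd_above_summable_on bdd_aboveI2[where M = "K\<^sup>2"]) simp_all
qed

text \<open>
  The entries of the diagonal operator \<open>\<Pi>\<close> with \<open>U\<^sub>W = \<Pi> U \<Pi>\<^sup>-\<^sup>1\<close>.
\<close>

definition wprod :: "nat \<Rightarrow> real"
  where "wprod k = (\<Prod>l<k. w l)"

lemma wprod_Suc: "wprod (Suc k) = wprod k * w k"
  by (simp add: wprod_def)

lemma wprod_pos [simp]: "0 < wprod k"
  by (simp add: wprod_def prod_pos)

lemma wprod_nonneg [simp]: "0 \<le> wprod k"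
  by (rule less_imp_le[OF wprod_pos])

lemma wprod_nonzero [simp]: "wprod k \<noteq> 0"
  using wprod_pos[of k] by linarith

lemma wprod_0 [simp]: "wprod 0 = 1"
  by (simp add: wprod_def)

text \<open>
  After cancellation each factor \<open>w\<^sub>j\<^sub>+\<^sub>l\<close> on the left is matched by the larger factor \<open>w\<^sub>i\<^sub>+\<^sub>l\<close> on the
  right.  This makes the bound on the coefficients of \<open>primitive\<close> the same on all diagonals.
\<close>

lemma wprod_shift_mono: "j \<le> i \<Longrightarrow> wprod (j + t) * wprod i \<le> wprod j * wprod (i + t)"
proof (induction t)
  case 0
  then show ?case by simp
next
  case (Suc t)
  have "wprod (j + t) * wprod i * w (j + t) \<le> wprod j * wprod (i + t) * w (i + t)"
    by (rule mult_mono[OF Suc.IH[OF Suc.prems]])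
      (use w_mono Suc.prems in \<open>simp_all add: incseq_def\<close>)
  then show ?case
    by (simp add: wprod_Suc mult_ac)
qed

text \<open>
  Two-sided control on a fixed diagonal, where products of \<open>w\<close> over \<open>\<bar>i - j\<bar>\<close> indices are compared to
  powers of a common bound for \<open>w\<close> and \<open>1 / w\<close>.
\<close>

lemma wprod_le_power:
  "\<exists>L>0. \<forall>i j. wprod i \<le> L ^ nat \<bar>int i - int j\<bar> * wprod j"
proof -
  obtain K where K: "\<And>k. \<bar>w k\<bar> \<le> K"
    using w_bounded by (auto simp: bounded_iff)
  define L where "L = max K (1 / \<epsilon>)"
  have L: "0 < L" "w k \<le> L" "1 \<le> L * w k" for k
  proof -
    have "1 / \<epsilon> \<le> L" "K \<le> L"
      by (simp_all add: L_def)
    then show "0 < L"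
      using eps_pos by (smt (verit) divide_pos_pos)
    show "w k \<le> L"
      using K[of k] \<open>K \<le> L\<close> by linarith
    have "1 = (1 / \<epsilon>) * \<epsilon>"
      using eps_pos by simp
    also have "\<dots> \<le> L * w k"
      using \<open>1 / \<epsilon> \<le> L\<close> w_ge eps_pos \<open>0 < L\<close> by (intro mult_mono) auto
    finally show "1 \<le> L * w k" .
  qed
  have up: "wprod (j + m) \<le> L ^ m * wprod j" for j m
  proof (induction m)
    case (Suc m)
    have "wprod (j + m) * w (j + m) \<le> (L ^ m * wprod j) * L"
      using Suc L by (intro mult_mono) (auto simp: less_imp_le)
    then show ?case
      by (simp add: wprod_Suc mult_ac)
  qed simp
  have down: "wprod j \<le> L ^ m * wprod (j + m)" for j m
  proof (induction m)
    case (Suc m)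
    have "wprod j * 1 \<le> (L ^ m * wprod (j + m)) * (L * w (j + m))"
      using Suc L by (intro mult_mono) (auto simp: less_imp_le)
    then show ?case
      by (simp add: wprod_Suc mult_ac)
  qed simp
  have "wprod i \<le> L ^ nat \<bar>int i - int j\<bar> * wprod j" for i j
  proof (cases "j \<le> i")
    case True
    then show ?thesis
      using up[of j "i - j"] by (simp add: nat_diff_distrib' flip: of_nat_diff)
  next
    case False
    then have "nat \<bar>int i - int j\<bar> = j - i"
      by linarith
    then show ?thesis
      using down[of i "j - i"] False by simp
  qed
  then show ?thesis
    using L(1) by blast
qed

subsection \<open>Decay of the weights away from the main diagonal\<close>

definition diag_weight :: "int \<Rightarrow> real"
  where "diag_weight d = infsum wt (diagonal d)"

lemma s_diagonal_summable:
  "(\<lambda>x. s_seq w (fst x)) summable_on diagonal d" "(\<lambda>x. s_seq w (snd x)) summable_on diagonal d"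
proof -
  have "s_seq w summable_on fst ` diagonal d" "s_seq w summable_on snd ` diagonal d"
    using s_summable summable_on_subset_banach by blast+
  then show "(\<lambda>x. s_seq w (fst x)) summable_on diagonal d" "(\<lambda>x. s_seq w (snd x)) summable_on diagonal d"
    by (simp_all add: summable_on_reindex inj_on_diagonal o_def)
qed

lemma wt_diagonal:
  shows wt_summable: "wt summable_on diagonal d"
    and diag_weight_le: "diag_weight d \<le> sqrt (\<Sum>\<^sub>\<infinity>x\<in>diagonal d. s_seq w (fst x)) * sqrt (\<Sum>\<^sub>\<infinity>x\<in>diagonal d. s_seq w (snd x))"
proof -
  have sq: "(sqrt (s_seq w k))\<^sup>2 = s_seq w k" for k
    using s_pos[of k] by simp
  have wt: "\<bar>sqrt (s_seq w (fst x)) * sqrt (s_seq w (snd x))\<bar> = wt x" for x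
    using wt_nonneg[of x] by (simp add: wt_def)
  note CS = Cauchy_Schwarz_infsum[of "\<lambda>x. sqrt (s_seq w (fst x))" "diagonal d" "\<lambda>x. sqrt (s_seq w (snd x))",
      unfolded sq wt, OF s_diagonal_summable]
  show "wt summable_on diagonal d"
    by (rule CS(1))
  show "diag_weight d \<le> sqrt (\<Sum>\<^sub>\<infinity>x\<in>diagonal d. s_seq w (fst x)) * sqrt (\<Sum>\<^sub>\<infinity>x\<in>diagonal d. s_seq w (snd x))"
    unfolding diag_weight_def by (rule CS(2))
qed

lemma diag_weight_nonneg [simp]: "0 \<le> diag_weight d"
  by (simp add: diag_weight_def infsum_nonneg)

lemma s_coordinate_sum_le:
  assumes "\<And>G. \<lbrakk>finite G; G \<subseteq> A\<rbrakk> \<Longrightarrow> sum (s_seq w) G \<le> e"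
  shows "fst ` diagonal d \<subseteq> A \<Longrightarrow> (\<Sum>\<^sub>\<infinity>x\<in>diagonal d. s_seq w (fst x)) \<le> e"
    and "snd ` diagonal d \<subseteq> A \<Longrightarrow> (\<Sum>\<^sub>\<infinity>x\<in>diagonal d. s_seq w (snd x)) \<le> e"
proof -
  assume A: "fst ` diagonal d \<subseteq> A"
  show "(\<Sum>\<^sub>\<infinity>x\<in>diagonal d. s_seq w (fst x)) \<le> e"
  proof (rule infsum_le_finite_sums[OF s_diagonal_summable(1)])
    fix G assume G: "finite G" "G \<subseteq> diagonal d"
    then have "(\<Sum>x\<in>G. s_seq w (fst x)) = sum (s_seq w) (fst ` G)"
      using inj_on_subset[OF inj_on_diagonal(1)] by (simp add: sum.reindex)
    also have "\<dots> \<le> e"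
      using G A by (intro assms) auto
    finally show "(\<Sum>x\<in>G. s_seq w (fst x)) \<le> e" .
  qed
next
  assume A: "snd ` diagonal d \<subseteq> A"
  show "(\<Sum>\<^sub>\<infinity>x\<in>diagonal d. s_seq w (snd x)) \<le> e"
  proof (rule infsum_le_finite_sums[OF s_diagonal_summable(2)])
    fix G assume G: "finite G" "G \<subseteq> diagonal d"
    then have "(\<Sum>x\<in>G. s_seq w (snd x)) = sum (s_seq w) (snd ` G)"
      using inj_on_subset[OF inj_on_diagonal(2)] by (simp add: sum.reindex)
    also have "\<dots> \<le> e"
      using G A by (intro assms) auto
    finally show "(\<Sum>x\<in>G. s_seq w (snd x)) \<le> e" .
  qed
qed

lemma trace_s_pos: "0 < infsum (s_seq w) UNIV"
proof -
  have "0 < sum (s_seq w) {0}"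
    using s_pos by simp
  also have "\<dots> \<le> infsum (s_seq w) UNIV"
    using s_pos by (intro finite_sum_le_infsum s_summable) (auto simp: less_imp_le)
  finally show ?thesis .
qed

lemma s_sum_le_trace: "finite G \<Longrightarrow> sum (s_seq w) G \<le> infsum (s_seq w) UNIV"
  using s_pos by (intro finite_sum_le_infsum s_summable) (auto simp: less_imp_le)

lemma diag_weight_le_trace: "diag_weight d \<le> infsum (s_seq w) UNIV"
proof -
  let ?t = "infsum (s_seq w) UNIV"
  have "diag_weight d \<le> sqrt ?t * sqrt ?t"
    using s_sum_le_trace
    by (intro order_trans[OF diag_weight_le] mult_mono real_sqrt_le_mono s_coordinate_sum_le[of UNIV])
      (auto intro!: infsum_nonneg less_imp_le[OF s_pos] less_imp_le[OF trace_s_pos])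
  then show ?thesis
    using trace_s_pos by simp
qed

text \<open>
  On the diagonal \<open>d\<close> one of the two indices is at least \<open>\<bar>d\<bar>\<close>, so by the Cauchy-Schwarz inequality the
  weight is at most \<open>(tr S)\<^sup>1\<^sup>/\<^sup>2\<close> times the square root of a tail of the trace of \<open>S\<close>.
\<close>

lemma finite_diag_weight_greater:
  assumes e: "0 < e"
  shows "finite {d. e < diag_weight d}"
proof -
  let ?t = "infsum (s_seq w) UNIV"
  have "0 < e\<^sup>2 / ?t"
    using e trace_s_pos by simp
  from summable_on_tail[OF s_summable s_nonneg this]
  obtain F where F: "finite F"
    and tail: "\<And>G. \<lbrakk>finite G; G \<inter> F = {}\<rbrakk> \<Longrightarrow> sum (s_seq w) G \<le> e\<^sup>2 / ?t"
    by auto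
  obtain m where m: "F \<subseteq> {..<m}"
    using F finite_nat_iff_bounded by blast
  have far: "sum (s_seq w) G \<le> e\<^sup>2 / ?t" if "finite G" "G \<subseteq> {m..}" for G
  proof (rule tail[OF that(1)])
    have "{m..} \<inter> {..<m} = {}"
      by auto
    then show "G \<inter> F = {}"
      using m that(2) by blast
  qed
  have eq: "sqrt ?t * sqrt (e\<^sup>2 / ?t) = e"
    using e trace_s_pos by (simp add: real_sqrt_mult[symmetric])
  have "diag_weight d \<le> e" if d: "int m \<le> \<bar>d\<bar>" for d
  proof (cases "0 \<le> d")
    case True
    then have sub: "fst ` diagonal d \<subseteq> {m..}"
      using d by (auto simp: offset_def)
    have "diag_weight d \<le> sqrt (e\<^sup>2 / ?t) * sqrt ?t"
      using s_sum_le_trace far sub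
      by (intro order_trans[OF diag_weight_le] mult_mono real_sqrt_le_mono
          s_coordinate_sum_le(1)[of "{m..}"] s_coordinate_sum_le(2)[of UNIV])
        (auto intro!: infsum_nonneg less_imp_le[OF s_pos] less_imp_le[OF trace_s_pos] divide_nonneg_nonneg)
    then show ?thesis
      using eq by (simp add: mult.commute)
  next
    case False
    then have sub: "snd ` diagonal d \<subseteq> {m..}"
      using d by (auto simp: offset_def)
    have "diag_weight d \<le> sqrt ?t * sqrt (e\<^sup>2 / ?t)"
      using s_sum_le_trace far sub
      by (intro order_trans[OF diag_weight_le] mult_mono real_sqrt_le_mono
          s_coordinate_sum_le(2)[of "{m..}"] s_coordinate_sum_le(1)[of UNIV])
        (auto intro!: infsum_nonneg less_imp_le[OF s_pos] less_imp_le[OF trace_s_pos] divide_nonneg_nonneg)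
    then show ?thesis
      using eq by simp
  qed
  then have "{d. e < diag_weight d} \<subseteq> {- int m..int m}"
    by (force simp: not_le[symmetric])
  then show ?thesis
    by (rule finite_subset) simp
qed

subsection \<open>The primitive of a matrix\<close>

text \<open>
  The inhomogeneity of the difference equation \<open>h\<^sub>i\<^sub>,\<^sub>j\<^sub>+\<^sub>1 - h\<^sub>i\<^sub>-\<^sub>1\<^sub>,\<^sub>j = \<Pi>\<^sub>j \<Pi>\<^sub>i\<^sup>-\<^sup>1 S\<^sub>i\<^sup>1\<^sup>/\<^sup>2 S\<^sub>j\<^sup>1\<^sup>/\<^sup>2 b\<^sub>i\<^sub>j\<close>, equivalent to
  \<open>D a = b\<close> for \<open>h = \<Pi>\<^sup>-\<^sup>1 a \<Pi>\<close>.
\<close>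

definition increment :: "cmat \<Rightarrow> nat \<times> nat \<Rightarrow> complex"
  where "increment b x = complex_of_real (wprod (snd x) / wprod (fst x) * wt x) * entry b x"

text \<open>
  The entries that determine \<open>primitive b\<close> at \<open>(i, j)\<close>: the part of the next diagonal before row \<open>i + 1\<close> if
  \<open>i < j\<close>, and the part from row \<open>i + 1\<close> onwards if \<open>i \<ge> j\<close>.  Summing from infinity on the diagonals \<open>d \<ge> 0\<close>
  enforces boundary value zero there, which singles out one solution despite the kernel of \<open>D\<close>.
\<close>

definition half_diagonal :: "nat \<Rightarrow> nat \<Rightarrow> (nat \<times> nat) set"
  where "half_diagonal i j =
    {x \<in> diagonal (int i - int j + 1). if i < j then fst x \<le> i else i < fst x}"

definition primitive :: "cmat \<Rightarrow> cmat"
  where "primitive b = (\<lambda>i j. complex_of_real ((if i < j then 1 else - 1) * (wprod i / wprod j))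
    * infsum (increment b) (half_diagonal i j))"

lemma half_diagonal_subset: "half_diagonal i j \<subseteq> diagonal (int i - int j + 1)"
  by (auto simp: half_diagonal_def)

text \<open>
  The coefficients of \<open>primitive\<close>, apart from the weight, are at most \<open>1 / \<epsilon>\<close>.  In both cases the two index pairs are related by
  a shift along the diagonal, so \<open>wprod_shift_mono\<close> applies, and one factor \<open>w \<ge> \<epsilon>\<close> is left over
  because \<open>x\<close> lies on the next diagonal.
\<close>

lemma half_diagonal_ratio:
  assumes "x \<in> half_diagonal i j"
  shows "\<epsilon> * (wprod i * wprod (snd x)) \<le> wprod j * wprod (fst x)"
proof (cases "i < j")
  case True
  define t where "t = i - fst x"
  have i: "i = fst x + t" and j: "j = Suc (snd x + t)" and le: "fst x \<le> snd x"
    using assms True by (auto simp: half_diagonal_def offset_def t_def)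
  have "\<epsilon> * (wprod i * wprod (snd x)) \<le> w (snd x + t) * (wprod (fst x) * wprod (snd x + t))"
    unfolding i using w_ge eps_pos by (intro mult_mono wprod_shift_mono le) auto
  then show ?thesis
    by (simp add: j wprod_Suc mult_ac)
next
  case False
  define t where "t = fst x - Suc i"
  have x: "fst x = Suc (i + t)" "snd x = j + t" and le: "j \<le> i"
    using assms False by (auto simp: half_diagonal_def offset_def t_def)
  have "wprod (j + t) * wprod i \<le> wprod j * wprod (i + t)"
    using le by (rule wprod_shift_mono)
  then have "\<epsilon> * (wprod (j + t) * wprod i) \<le> w (i + t) * (wprod j * wprod (i + t))"
    by (rule mult_mono[OF w_ge]) simp_all
  then show ?thesis
    by (simp add: x wprod_Suc mult_ac)
qed

definition diag_energy :: "cmat \<Rightarrow> int \<Rightarrow> real"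
  where "diag_energy b d = infsum (energy b) (diagonal d)"

lemma diag_energy_nonneg [simp]: "0 \<le> diag_energy b d"
  by (simp add: diag_energy_def infsum_nonneg)

lemma energy_summable_on: "b \<in> nc_space w \<Longrightarrow> energy b summable_on A"
  unfolding nc_space_iff by (rule summable_on_subset_banach) auto

lemma sum_diag_energy_le:
  assumes b: "b \<in> nc_space w" and D: "finite D"
  shows "(\<Sum>d\<in>D. diag_energy b d) \<le> (nrm b)\<^sup>2"
proof -
  have "(\<Sum>d\<in>D. diag_energy b d) = infsum (energy b) (\<Union>d\<in>D. diagonal d)"
    unfolding diag_energy_def by (intro sum_infsum D energy_summable_on b) auto
  also have "\<dots> \<le> infsum (energy b) UNIV"
    using energy_summable_on[OF b] by (intro infsum_mono2) auto
  also have "\<dots> = (nrm b)\<^sup>2"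
    by (simp add: nrm_sq_infsum b)
  finally show ?thesis .
qed

lemma weighted_diagonal_sum:
  assumes b: "b \<in> nc_space w"
  shows weighted_diagonal_summable: "(\<lambda>x. wt x * cmod (entry b x)) summable_on diagonal d"
    and weighted_diagonal_sum_le:
      "(\<Sum>\<^sub>\<infinity>x\<in>diagonal d. wt x * cmod (entry b x)) \<le> sqrt (diag_weight d) * sqrt (diag_energy b d)"
proof -
  have sq: "(sqrt (wt x))\<^sup>2 = wt x" for x
    by simp
  have prod: "\<bar>sqrt (wt x) * (sqrt (wt x) * cmod (entry b x))\<bar> = wt x * cmod (entry b x)" for x
  proof -
    have "sqrt (wt x) * (sqrt (wt x) * cmod (entry b x)) = (sqrt (wt x) * sqrt (wt x)) * cmod (entry b x)"
      by (simp only: mult.assoc)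
    also have "sqrt (wt x) * sqrt (wt x) = wt x"
      by (rule real_sqrt_mult_self[of "wt x", unfolded abs_of_nonneg[OF wt_nonneg]])
    finally show ?thesis
      by simp
  qed
  note CS = Cauchy_Schwarz_infsum[of "\<lambda>x. sqrt (wt x)" "diagonal d" "\<lambda>x. sqrt (wt x) * cmod (entry b x)",
      unfolded sq prod energy_sqrt, OF wt_summable energy_summable_on[OF b]]
  show "(\<lambda>x. wt x * cmod (entry b x)) summable_on diagonal d"
    by (rule CS(1))
  show "(\<Sum>\<^sub>\<infinity>x\<in>diagonal d. wt x * cmod (entry b x)) \<le> sqrt (diag_weight d) * sqrt (diag_energy b d)"
    unfolding diag_weight_def diag_energy_def by (rule CS(2))
qed

lemma cmod_increment: "cmod (increment b x) = wprod (snd x) / wprod (fst x) * (wt x * cmod (entry b x))"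
  by (simp add: increment_def norm_mult norm_divide)

lemma increment_norm_summable:
  assumes b: "b \<in> nc_space w" and A: "A \<subseteq> diagonal d"
  shows "(\<lambda>x. cmod (increment b x)) summable_on A"
proof -
  obtain L where L: "\<And>i j. wprod i \<le> L ^ nat \<bar>int i - int j\<bar> * wprod j"
    using wprod_le_power by blast
  have "(\<lambda>x. L ^ nat \<bar>d\<bar> * (wt x * cmod (entry b x))) summable_on A"
    using A weighted_diagonal_summable[OF b]
    by (intro summable_on_cmult_right) (rule summable_on_subset_banach)
  then show ?thesis
  proof (rule summable_on_comparison_test)
    fix x assume x: "x \<in> A"
    have "\<bar>int (snd x) - int (fst x)\<bar> = \<bar>d\<bar>"
      using x A by (auto simp: offset_def)
    then have "wprod (snd x) / wprod (fst x) \<le> L ^ nat \<bar>d\<bar>"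
      using L[of "snd x" "fst x"] by (simp add: pos_divide_le_eq)
    then show "cmod (increment b x) \<le> L ^ nat \<bar>d\<bar> * (wt x * cmod (entry b x))"
      unfolding cmod_increment by (intro mult_right_mono) auto
  qed simp
qed

lemma increment_summable: "b \<in> nc_space w \<Longrightarrow> A \<subseteq> diagonal d \<Longrightarrow> increment b summable_on A"
  by (rule abs_summable_summable) (rule increment_norm_summable)

lemma cmod_primitive_le:
  assumes b: "b \<in> nc_space w"
  shows "cmod (primitive b i j) \<le> (\<Sum>\<^sub>\<infinity>x\<in>diagonal (int i - int j + 1). wt x * cmod (entry b x)) / \<epsilon>"
proof -
  let ?H = "half_diagonal i j" and ?D = "diagonal (int i - int j + 1)"
  note sH = increment_norm_summable[OF b half_diagonal_subset, of i j]
  have wt_H: "(\<lambda>x. wt x * cmod (entry b x)) summable_on ?H"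
    using weighted_diagonal_summable[OF b] half_diagonal_subset by (rule summable_on_subset_banach)
  have "cmod (primitive b i j) = wprod i / wprod j * cmod (infsum (increment b) ?H)"
    by (simp add: primitive_def norm_mult norm_divide)
  also have "\<dots> \<le> wprod i / wprod j * (\<Sum>\<^sub>\<infinity>x\<in>?H. cmod (increment b x))"
    using sH by (intro mult_left_mono norm_infsum_bound) auto
  also have "\<dots> = (\<Sum>\<^sub>\<infinity>x\<in>?H. wprod i / wprod j * cmod (increment b x))"
    by (rule infsum_cmult_right'[symmetric])
  also have "\<dots> \<le> (\<Sum>\<^sub>\<infinity>x\<in>?H. 1 / \<epsilon> * (wt x * cmod (entry b x)))"
  proof (rule infsum_mono)
    show "(\<lambda>x. wprod i / wprod j * cmod (increment b x)) summable_on ?H"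
      by (rule summable_on_cmult_right[OF sH])
    show "(\<lambda>x. 1 / \<epsilon> * (wt x * cmod (entry b x))) summable_on ?H"
      by (rule summable_on_cmult_right[OF wt_H])
    fix x assume "x \<in> ?H"
    then have "wprod i / wprod j * (wprod (snd x) / wprod (fst x)) \<le> 1 / \<epsilon>"
      using half_diagonal_ratio[of x i j] eps_pos by (simp add: divide_simps mult_ac)
    then have "wprod i / wprod j * (wprod (snd x) / wprod (fst x)) * (wt x * cmod (entry b x))
        \<le> 1 / \<epsilon> * (wt x * cmod (entry b x))"
      by (rule mult_right_mono) simp
    then show "wprod i / wprod j * cmod (increment b x) \<le> 1 / \<epsilon> * (wt x * cmod (entry b x))"
      by (simp add: cmod_increment)
  qed
  also have "\<dots> = 1 / \<epsilon> * (\<Sum>\<^sub>\<infinity>x\<in>?H. wt x * cmod (entry b x))"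
    by (rule infsum_cmult_right')
  also have "\<dots> \<le> 1 / \<epsilon> * (\<Sum>\<^sub>\<infinity>x\<in>?D. wt x * cmod (entry b x))"
    using half_diagonal_subset wt_H weighted_diagonal_summable[OF b] eps_pos
    by (intro mult_left_mono infsum_mono2) auto
  finally show ?thesis
    by simp
qed

definition gain :: "int \<Rightarrow> real"
  where "gain d = diag_weight (d + 1) / \<epsilon>\<^sup>2"

lemma gain_nonneg [simp]: "0 \<le> gain d"
  by (simp add: gain_def)

text \<open>
  The bound on the coefficients together with the Cauchy-Schwarz inequality.  Summation of this bound over a
  diagonal produces a second weight factor, so that \<open>gain d * diag_weight d\<close> bounds the squared norm of
  \<open>primitive\<close> from the diagonal \<open>d + 1\<close> to the diagonal \<open>d\<close>.
\<close>

lemma energy_primitive_le: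
  assumes b: "b \<in> nc_space w"
  shows "energy (primitive b) x \<le> wt x * (gain (offset x) * diag_energy b (offset x + 1))"
proof -
  let ?d = "offset x + 1"
  have "cmod (entry (primitive b) x) \<le> (\<Sum>\<^sub>\<infinity>x\<in>diagonal ?d. wt x * cmod (entry b x)) / \<epsilon>"
    using cmod_primitive_le[OF b, of "fst x" "snd x"] by (simp add: entry_def offset_def)
  also have "\<dots> \<le> sqrt (diag_weight ?d) * sqrt (diag_energy b ?d) / \<epsilon>"
    using weighted_diagonal_sum_le[OF b] eps_pos by (intro divide_right_mono) auto
  finally have "(cmod (entry (primitive b) x))\<^sup>2 \<le> (sqrt (diag_weight ?d) * sqrt (diag_energy b ?d) / \<epsilon>)\<^sup>2"
    by (rule power_mono) simp
  also have "\<dots> = gain (offset x) * diag_energy b ?d"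
    by (simp add: gain_def power_mult_distrib power_divide)
  finally show ?thesis
    unfolding energy_def by (rule mult_left_mono) simp
qed

lemma sum_energy_primitive_le:
  assumes b: "b \<in> nc_space w" and G: "finite G"
  shows "sum (energy (primitive b)) G
    \<le> (\<Sum>d\<in>offset ` G. gain d * diag_energy b (d + 1) * sum wt {x \<in> G. offset x = d})"
proof -
  have "sum (energy (primitive b)) G \<le> (\<Sum>x\<in>G. wt x * (gain (offset x) * diag_energy b (offset x + 1)))"
    by (intro sum_mono energy_primitive_le b)
  also have "\<dots> = (\<Sum>d\<in>offset ` G. \<Sum>x\<in>{x \<in> G. offset x = d}.
      wt x * (gain (offset x) * diag_energy b (offset x + 1)))"
    using G by (intro sum.group[symmetric]) auto
  also have "\<dots> = (\<Sum>d\<in>offset ` G. gain d * diag_energy b (d + 1) * sum wt {x \<in> G. offset x = d})"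
    by (intro sum.cong refl) (simp add: sum_distrib_left mult.commute)
  finally show ?thesis .
qed

lemma sum_wt_le_diag_weight: "finite G \<Longrightarrow> sum wt {x \<in> G. offset x = d} \<le> diag_weight d"
  unfolding diag_weight_def by (intro finite_sum_le_infsum wt_summable) auto

lemma sum_energy_primitive_gain_le:
  assumes b: "b \<in> nc_space w" and G: "finite G" and e: "0 \<le> e"
    and gain: "\<And>x. x \<in> G \<Longrightarrow> gain (offset x) * diag_weight (offset x) \<le> e"
  shows "sum (energy (primitive b)) G \<le> e * (nrm b)\<^sup>2"
proof -
  have "sum (energy (primitive b)) G
      \<le> (\<Sum>d\<in>offset ` G. gain d * diag_energy b (d + 1) * sum wt {x \<in> G. offset x = d})"
    by (rule sum_energy_primitive_le[OF b G])
  also have "\<dots> \<le> (\<Sum>d\<in>offset ` G. e * diag_energy b (d + 1))"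
  proof (rule sum_mono)
    fix d assume d: "d \<in> offset ` G"
    have "gain d * diag_energy b (d + 1) * sum wt {x \<in> G. offset x = d} \<le> gain d * diag_energy b (d + 1) * diag_weight d"
      using sum_wt_le_diag_weight[OF G] by (intro mult_left_mono) auto
    also have "\<dots> = (gain d * diag_weight d) * diag_energy b (d + 1)"
      by simp
    also have "\<dots> \<le> e * diag_energy b (d + 1)"
      using d gain by (intro mult_right_mono) auto
    finally show "gain d * diag_energy b (d + 1) * sum wt {x \<in> G. offset x = d} \<le> e * diag_energy b (d + 1)" .
  qed
  also have "\<dots> = e * (\<Sum>d\<in>(\<lambda>d. d + 1) ` offset ` G. diag_energy b d)"
    by (simp add: sum_distrib_left sum.reindex)
  also have "\<dots> \<le> e * (nrm b)\<^sup>2"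
    using G e by (intro mult_left_mono sum_diag_energy_le b) auto
  finally show ?thesis .
qed

lemma gain_diag_weight_le: "gain d * diag_weight d \<le> infsum (s_seq w) UNIV / \<epsilon>\<^sup>2 * diag_weight d"
  unfolding gain_def using diag_weight_le_trace by (intro mult_right_mono divide_right_mono) auto

lemma sum_energy_primitive_bounded:
  "\<exists>B\<ge>0. \<forall>b\<in>nc_space w. \<forall>G. finite G \<longrightarrow> sum (energy (primitive b)) G \<le> B\<^sup>2 * (nrm b)\<^sup>2"
proof -
  let ?t = "infsum (s_seq w) UNIV"
  define B where "B = ?t / \<epsilon>"
  have "0 \<le> B"
    using trace_s_pos eps_pos by (simp add: B_def)
  moreover have le: "gain d * diag_weight d \<le> B\<^sup>2" for d
  proof -
    have "gain d * diag_weight d \<le> ?t / \<epsilon>\<^sup>2 * diag_weight d"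
      by (rule gain_diag_weight_le)
    also have "\<dots> \<le> ?t / \<epsilon>\<^sup>2 * ?t"
      using diag_weight_le_trace trace_s_pos by (intro mult_left_mono) auto
    also have "\<dots> = B\<^sup>2"
      by (simp add: B_def power2_eq_square)
    finally show ?thesis .
  qed
  have "sum (energy (primitive b)) G \<le> B\<^sup>2 * (nrm b)\<^sup>2" if "b \<in> nc_space w" "finite G" for b G
    using le by (intro sum_energy_primitive_gain_le that) auto
  ultimately show ?thesis
    by blast
qed

lemma primitive_mem: "b \<in> nc_space w \<Longrightarrow> primitive b \<in> nc_space w"
  using sum_energy_primitive_bounded nrm_sq_leI(1) by metis

lemma primitive_bounded: "\<exists>B. \<forall>b\<in>nc_space w. nrm (primitive b) \<le> B * nrm b"
proof -
  obtain B where B0: "0 \<le> B"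
    and B: "\<And>b G. \<lbrakk>b \<in> nc_space w; finite G\<rbrakk> \<Longrightarrow> sum (energy (primitive b)) G \<le> B\<^sup>2 * (nrm b)\<^sup>2"
    using sum_energy_primitive_bounded by blast
  have "nrm (primitive b) \<le> B * nrm b" if b: "b \<in> nc_space w" for b
  proof (rule power2_le_imp_le)
    show "(nrm (primitive b))\<^sup>2 \<le> (B * nrm b)\<^sup>2"
      using nrm_sq_leI(2)[OF B[OF b]] by (simp add: power_mult_distrib)
    show "0 \<le> B * nrm b"
      using B0 by simp
  qed
  then show ?thesis
    by blast
qed

lemma operator_on_primitive: "operator_on (nc_space w) (nc_space w) primitive"
proof -
  have "primitive (a + b) = primitive a + primitive b" if "a \<in> nc_space w" "b \<in> nc_space w" for a b
  proof (intro ext)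
    fix i j
    have "increment (a + b) = (\<lambda>x. increment a x + increment b x)"
      by (intro ext) (simp only: increment_def entry_simps distrib_left)
    then have "infsum (increment (a + b)) (half_diagonal i j)
        = infsum (increment a) (half_diagonal i j) + infsum (increment b) (half_diagonal i j)"
      using increment_summable[OF _ half_diagonal_subset] that by (simp add: infsum_add)
    then show "primitive (a + b) i j = (primitive a + primitive b) i j"
      by (simp only: primitive_def plus_fun_apply distrib_left)
  qed
  moreover have "primitive (mscale z a) = mscale z (primitive a)" for z a
  proof (intro ext)
    fix i j
    have "increment (mscale z a) = (\<lambda>x. z * increment a x)"
      by (simp add: fun_eq_iff increment_def)
    then have "infsum (increment (mscale z a)) (half_diagonal i j) = z * infsum (increment a) (half_diagonal i j)"
      by (simp add: infsum_cmult_right')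
    then show "primitive (mscale z a) i j = mscale z (primitive a) i j"
      by (simp add: primitive_def mscale_def)
  qed
  ultimately show ?thesis
    unfolding operator_on_def using primitive_mem nc_space_subspace by blast
qed

text \<open>
  Outside finitely many diagonals the operator is small in norm.  On each of the remaining diagonals
  the image of the unit ball is dominated by a multiple of the summable weight, so a finite set of
  entries carries all but a small part of the energy.
\<close>

lemma primitive_tails:
  assumes e: "0 < e"
  shows "\<exists>F. finite F \<and> (\<forall>b\<in>nc_space w. nrm b \<le> 1 \<longrightarrow>
    (\<forall>G. finite G \<longrightarrow> G \<inter> F = {} \<longrightarrow> sum (energy (primitive b)) G \<le> 2 * e))"
proof -
  let ?t = "infsum (s_seq w) UNIV"
  \<comment> \<open>Off this set \<open>gain_diag_weight_le\<close> gives the bound \<open>e\<close>.\<close>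
  define D where "D = {d. e * \<epsilon>\<^sup>2 / ?t < diag_weight d}"
  have "finite D"
    unfolding D_def using e eps_pos trace_s_pos by (intro finite_diag_weight_greater) simp
  have small: "gain d * diag_weight d \<le> e" if "d \<notin> D" for d
  proof -
    have "gain d * diag_weight d \<le> ?t / \<epsilon>\<^sup>2 * diag_weight d"
      by (rule gain_diag_weight_le)
    also have "\<dots> \<le> ?t / \<epsilon>\<^sup>2 * (e * \<epsilon>\<^sup>2 / ?t)"
      using that trace_s_pos by (intro mult_left_mono) (auto simp: D_def)
    also have "\<dots> = e"
      using trace_s_pos eps_pos by simp
    finally show ?thesis .
  qed
  \<comment> \<open>The contributions of the diagonals in \<open>D\<close> add up to at most \<open>e\<close>;
    \<open>gain d + 1\<close> avoids a division by zero.\<close>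
  define c where "c d = e / ((gain d + 1) * (card D + 1))" for d
  have c_pos: "0 < c d" for d
    using e gain_nonneg[of d] by (simp add: c_def add_nonneg_pos)
  have "\<exists>F. finite F \<and> (\<forall>G. finite G \<longrightarrow> G \<subseteq> diagonal d \<longrightarrow> G \<inter> F = {} \<longrightarrow> sum wt G \<le> c d)" for d
    by (rule summable_on_tail[OF wt_summable wt_nonneg c_pos])
  then obtain F where F: "\<And>d. finite (F d)"
    and F_tail: "\<And>d G. \<lbrakk>finite G; G \<subseteq> diagonal d; G \<inter> F d = {}\<rbrakk> \<Longrightarrow> sum wt G \<le> c d"
    by metis
  have "sum (energy (primitive b)) G \<le> 2 * e"
    if b: "b \<in> nc_space w" and b1: "nrm b \<le> 1" and G: "finite G" and disj: "G \<inter> (\<Union>d\<in>D. F d) = {}"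
    for b G
  proof -
    have nb: "(nrm b)\<^sup>2 \<le> 1"
      using b1 by (simp add: power_le_one)
    have far: "sum (energy (primitive b)) {x \<in> G. offset x \<notin> D} \<le> e * (nrm b)\<^sup>2"
      using G e small by (intro sum_energy_primitive_gain_le b) auto
    let ?G = "{x \<in> G. offset x \<in> D}"
    have "sum (energy (primitive b)) ?G
        \<le> (\<Sum>d\<in>offset ` ?G. gain d * diag_energy b (d + 1) * sum wt {x \<in> ?G. offset x = d})"
      using G by (intro sum_energy_primitive_le b) auto
    also have "\<dots> \<le> (\<Sum>d\<in>offset ` ?G. e / (card D + 1))"
    proof (rule sum_mono)
      fix d assume d: "d \<in> offset ` ?G"
      have "sum wt {x \<in> ?G. offset x = d} \<le> c d"
        using G disj d by (intro F_tail) auto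
      moreover have "diag_energy b (d + 1) \<le> 1"
        using sum_diag_energy_le[OF b, of "{d + 1}"] nb by simp
      ultimately have "gain d * diag_energy b (d + 1) * sum wt {x \<in> ?G. offset x = d} \<le> (gain d + 1) * 1 * c d"
        using c_pos[of d] by (intro mult_mono) (auto intro: sum_nonneg)
      also have "\<dots> = e / (card D + 1)"
        using gain_nonneg[of d] by (simp add: c_def add_nonneg_eq_0_iff)
      finally show "gain d * diag_energy b (d + 1) * sum wt {x \<in> ?G. offset x = d} \<le> e / (card D + 1)" .
    qed
    also have "\<dots> = card (offset ` ?G) * (e / (card D + 1))"
      by simp
    also have "\<dots> \<le> (card D + 1) * (e / (card D + 1))"
    proof (intro mult_right_mono)
      have "card (offset ` ?G) \<le> card D"
        using \<open>finite D\<close> by (intro card_mono) auto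
      then show "real (card (offset ` ?G)) \<le> real (card D + 1)"
        by simp
    qed (use e in simp)
    finally have near: "sum (energy (primitive b)) ?G \<le> e"
      by simp
    have "sum (energy (primitive b)) G = sum (energy (primitive b)) ?G + sum (energy (primitive b)) {x \<in> G. offset x \<notin> D}"
      using G by (subst sum.union_disjoint[symmetric]) (auto intro!: sum.cong)
    also have "\<dots> \<le> e + e * 1"
      using near far mult_left_mono[OF nb less_imp_le[OF e]] by linarith
    finally show ?thesis
      by simp
  qed
  then show ?thesis
    using F \<open>finite D\<close> by (intro exI[of _ "\<Union>d\<in>D. F d"]) auto
qed

lemma primitive_ball_compact:
  obtains T where "compactin H.M.mtopology T" "primitive ` {b \<in> nc_space w. nrm b \<le> 1} \<subseteq> T"
proof -
  obtain B where B: "\<And>b G. \<lbrakk>b \<in> nc_space w; finite G\<rbrakk> \<Longrightarrow> sum (energy (primitive b)) G \<le> B\<^sup>2 * (nrm b)\<^sup>2"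
    using sum_energy_primitive_bounded by blast
  define r :: "nat \<Rightarrow> real" where "r m = 2 * (1 / real (Suc m))" for m
  have "r \<longlonglongrightarrow> 2 * 0"
    unfolding r_def by (intro tendsto_mult tendsto_const lim_1_over_n[THEN LIMSEQ_Suc])
  then have r: "r \<longlonglongrightarrow> 0"
    by simp
  have "\<exists>F. finite F \<and> (\<forall>b\<in>nc_space w. nrm b \<le> 1 \<longrightarrow>
      (\<forall>G. finite G \<longrightarrow> G \<inter> F = {} \<longrightarrow> sum (energy (primitive b)) G \<le> r m))" for m
    unfolding r_def by (rule primitive_tails) simp
  then obtain F where F: "\<And>m. finite (F m)"
    and tail: "\<And>m b G. \<lbrakk>b \<in> nc_space w; nrm b \<le> 1; finite G; G \<inter> F m = {}\<rbrakk>
      \<Longrightarrow> sum (energy (primitive b)) G \<le> r m"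
    by metis
  have "sum (energy (primitive b)) G \<le> B\<^sup>2" if "b \<in> nc_space w" "nrm b \<le> 1" "finite G" for b G
  proof -
    have "B\<^sup>2 * (nrm b)\<^sup>2 \<le> B\<^sup>2 * 1"
      using that(2) by (intro mult_left_mono) (simp_all add: power_le_one)
    then show ?thesis
      using B[OF that(1,3)] by linarith
  qed
  then show ?thesis
    using tail by (intro that[OF compactin_uniform_tails[where F = F and B = "B\<^sup>2", OF F r]]) blast
qed

section \<open>The d-bar operator and its boundary values\<close>

lemma D_op_entry:
  "D_op w a i j = (a i (Suc j) * complex_of_real (w j)
    - (if i = 0 then 0 else complex_of_real (w (i - 1)) * a (i - 1) j)) / complex_of_real (wt (i, j))"
proof -
  have 1: "(a \<odot> weighted_shift w) i j = a i (Suc j) * complex_of_real (w j)"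
    unfolding mmul_def by (subst infsum_single[of "Suc j"]) (auto simp: weighted_shift_def)
  have 2: "(weighted_shift w \<odot> a) i j
      = (if i = 0 then 0 else complex_of_real (w (i - 1)) * a (i - 1) j)"
    unfolding mmul_def by (subst infsum_single[of "i - 1"]) (auto simp: weighted_shift_def)
  show ?thesis
    unfolding D_op_def S_inv_sqrt_def mmul_mdiag mdiag_mmul fun_diff_def 1 2
    by (simp add: wt_def)
qed

text \<open>
  The entries of \<open>\<Pi>\<^sup>-\<^sup>1 a \<Pi>\<close>.
\<close>

definition conjugated :: "cmat \<Rightarrow> nat \<Rightarrow> nat \<Rightarrow> complex"
  where "conjugated a i j = complex_of_real (wprod j / wprod i) * a i j"

lemma entry_eq_conjugated: "a i j = complex_of_real (wprod i / wprod j) * conjugated a i j"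
  by (simp add: conjugated_def)

lemma D_op_conjugated:
  "D_op w a i j = complex_of_real (wprod i / wprod j / wt (i, j))
    * (conjugated a i (Suc j) - (if i = 0 then 0 else conjugated a (i - 1) j))"
proof -
  have "complex_of_real (wprod i / wprod j) * conjugated a i (Suc j) = a i (Suc j) * complex_of_real (w j)"
    by (simp add: conjugated_def wprod_Suc)
  moreover have "complex_of_real (wprod i / wprod j) * conjugated a (i - 1) j
      = complex_of_real (w (i - 1)) * a (i - 1) j" if "i \<noteq> 0"
    using that by (cases i) (simp_all add: conjugated_def wprod_Suc)
  ultimately have eq: "complex_of_real (wprod i / wprod j)
        * (conjugated a i (Suc j) - (if i = 0 then 0 else conjugated a (i - 1) j))
      = a i (Suc j) * complex_of_real (w j)
        - (if i = 0 then 0 else complex_of_real (w (i - 1)) * a (i - 1) j)"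
    by (simp add: right_diff_distrib)
  show ?thesis
    unfolding D_op_entry eq[symmetric] by (simp only: of_real_divide times_divide_eq_left)
qed

lemma D_op_add: "D_op w (a + b) = D_op w a + D_op w b"
proof (intro ext)
  fix i j :: nat
  have conjugated: "conjugated (a + b) p q = conjugated a p q + conjugated b p q" for p q
    by (simp only: conjugated_def plus_fun_apply distrib_left)
  have "c * (p + q - (if i = 0 then 0 else p' + q'))
      = c * (p - (if i = 0 then 0 else p')) + c * (q - (if i = 0 then 0 else q'))"
    for c p q p' q' :: complex
    by (simp add: algebra_simps)
  then show "D_op w (a + b) i j = (D_op w a + D_op w b) i j"
    unfolding plus_fun_apply D_op_conjugated conjugated .
qed

lemma D_op_diff: "D_op w (a - b) = D_op w a - D_op w b"
  using D_op_add[of "a - b" b] by simp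

lemma D_op_mscale: "D_op w (mscale z a) = mscale z (D_op w a)"
proof (intro ext)
  fix i j :: nat
  have "conjugated (mscale z a) p q = z * conjugated a p q" for p q
    by (simp add: conjugated_def mscale_def)
  moreover have "c * (z * p - (if i = 0 then 0 else z * p')) = z * (c * (p - (if i = 0 then 0 else p')))"
    for c p p' :: complex
    by (simp add: algebra_simps)
  ultimately show "D_op w (mscale z a) i j = mscale z (D_op w a) i j"
    unfolding mscale_def[of z "D_op w a"] D_op_conjugated by (simp only:)
qed

lemma conjugated_primitive: "conjugated (primitive b) i j = (if i < j then 1 else - 1) * infsum (increment b) (half_diagonal i j)"
  by (simp add: conjugated_def primitive_def)

lemma infsum_insert_diagonal:
  assumes b: "b \<in> nc_space w" and B: "insert x B \<subseteq> diagonal d" and x: "x \<notin> B"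
  shows "infsum (increment b) (insert x B) = increment b x + infsum (increment b) B"
proof -
  have "infsum (increment b) ({x} \<union> B) = infsum (increment b) {x} + infsum (increment b) B"
    using B x by (intro infsum_Un_disjoint increment_summable[OF b, of _ d]) auto
  then show ?thesis
    by simp
qed

text \<open>
  Consecutive half diagonals differ by the single entry \<open>(i, j)\<close>, so the sums telescope.  Both entries of
  \<open>\<Pi>\<^sup>-\<^sup>1 a \<Pi>\<close> in the difference lie on the same diagonal and are therefore given by the same one of the
  two formulas.
\<close>

theorem D_op_primitive:
  assumes b: "b \<in> nc_space w"
  shows "D_op w (primitive b) = b"
proof (intro ext)
  fix i j
  have "conjugated (primitive b) i (Suc j) - (if i = 0 then 0 else conjugated (primitive b) (i - 1) j) = increment b (i, j)"
  proof (cases i)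
    case 0
    have "half_diagonal 0 (Suc j) = {(0, j)}"
      by (auto simp: half_diagonal_def offset_def)
    then show ?thesis
      by (simp add: 0 conjugated_primitive)
  next
    case (Suc i')
    show ?thesis
    proof (cases "i \<le> j")
      case True
      have H: "half_diagonal i (Suc j) = insert (i, j) (half_diagonal i' j)"
        using True Suc by (auto simp: half_diagonal_def offset_def)
      have "infsum (increment b) (insert (i, j) (half_diagonal i' j))
          = increment b (i, j) + infsum (increment b) (half_diagonal i' j)"
        using True Suc
        by (intro infsum_insert_diagonal[OF b, of _ _ "int i - int j"])
          (auto simp: half_diagonal_def offset_def)
      then show ?thesis
        using True Suc H by (simp add: conjugated_primitive)
    next
      case False
      have H: "half_diagonal i' j = insert (i, j) (half_diagonal i (Suc j))"
        using False Suc by (auto simp: half_diagonal_def offset_def)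
      have "infsum (increment b) (insert (i, j) (half_diagonal i (Suc j)))
          = increment b (i, j) + infsum (increment b) (half_diagonal i (Suc j))"
        using False Suc
        by (intro infsum_insert_diagonal[OF b, of _ _ "int i - int j"])
          (auto simp: half_diagonal_def offset_def)
      then show ?thesis
        using False Suc H by (simp add: conjugated_primitive)
    qed
  qed
  then have "D_op w (primitive b) i j = complex_of_real (wprod i / wprod j / wt (i, j)) * increment b (i, j)"
    unfolding D_op_conjugated by (rule arg_cong)
  also have "\<dots> = b i j"
    using less_imp_neq[OF wt_pos[of "(i, j)"]] by (simp add: increment_def entry_def)
  finally show "D_op w (primitive b) i j = b i j" .
qed

subsection \<open>Boundary values\<close>

definition w_inf :: real
  where "w_inf = lim w"

lemma w_inf_lim: "w \<longlonglongrightarrow> w_inf" and w_inf_pos [simp]: "0 < w_inf"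
proof -
  obtain l where "0 < l" "w \<longlonglongrightarrow> l"
    using w_limit .
  then show "w \<longlonglongrightarrow> w_inf" "0 < w_inf"
    by (simp_all add: w_inf_def limI)
qed

lemma w_inf_nonzero [simp]: "w_inf \<noteq> 0"
  using w_inf_pos by linarith

lemma wprod_ratio_lim: "(\<lambda>k. wprod (k + m) / wprod k) \<longlonglongrightarrow> w_inf ^ m"
proof (induction m)
  case (Suc m)
  have "(\<lambda>k. wprod (k + m) / wprod k * w (k + m)) \<longlonglongrightarrow> w_inf ^ m * w_inf"
    by (intro tendsto_mult Suc LIMSEQ_ignore_initial_segment[OF w_inf_lim])
  then show ?case
    by (simp add: wprod_Suc mult.commute)
qed simp

lemma fourier_conjugated:
  "0 \<le> d \<Longrightarrow> fourier a d k
    = complex_of_real (wprod (k + nat d) / wprod k) * conjugated a (k + nat d) k"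
  "d < 0 \<Longrightarrow> fourier a d k
    = complex_of_real (1 / (wprod (k + nat (- d)) / wprod k)) * conjugated a k (k + nat (- d))"
  by (simp_all add: fourier_def conjugated_def)

text \<open>
  Only finitely many points of a diagonal lie above a given row, so these sums run through a cofinal
  family of finite partial sums.
\<close>

lemma infsum_initial_diagonal_lim:
  assumes f: "f summable_on diagonal d"
  shows "(\<lambda>k. infsum f {x \<in> diagonal d. fst x \<le> k}) \<longlonglongrightarrow> infsum f (diagonal d)"
proof -
  have fin: "finite {x \<in> diagonal d. fst x \<le> k}" for k
  proof (rule inj_on_finite)
    show "inj_on fst {x \<in> diagonal d. fst x \<le> k}"
      by (rule inj_on_subset[OF inj_on_diagonal(1)[of d]]) auto
    show "fst ` {x \<in> diagonal d. fst x \<le> k} \<subseteq> {..k}"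
      by auto
  qed simp
  have "filterlim (\<lambda>k. {x \<in> diagonal d. fst x \<le> k}) (finite_subsets_at_top (diagonal d)) sequentially"
    unfolding filterlim_finite_subsets_at_top
  proof (intro allI impI)
    fix X assume X: "finite X \<and> X \<subseteq> diagonal d"
    then have "finite (fst ` X)"
      by simp
    then obtain m where m: "fst ` X \<subseteq> {..m}"
      unfolding finite_nat_iff_bounded_le ..
    show "\<forall>\<^sub>F k in sequentially. finite {x \<in> diagonal d. fst x \<le> k} \<and>
        X \<subseteq> {x \<in> diagonal d. fst x \<le> k} \<and> {x \<in> diagonal d. fst x \<le> k} \<subseteq> diagonal d"
    proof (rule eventually_sequentiallyI[of m])
      fix k assume k: "m \<le> k"
      have "fst x \<le> k" if "x \<in> X" for x
        using m k that by fastforce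
      then show "finite {x \<in> diagonal d. fst x \<le> k} \<and>
          X \<subseteq> {x \<in> diagonal d. fst x \<le> k} \<and> {x \<in> diagonal d. fst x \<le> k} \<subseteq> diagonal d"
        using fin X by blast
    qed
  qed
  then have "(\<lambda>k. sum f {x \<in> diagonal d. fst x \<le> k}) \<longlonglongrightarrow> infsum f (diagonal d)"
    by (rule filterlim_compose[OF infsum_tendsto[OF f]])
  then show ?thesis
    using fin by simp
qed

lemma infsum_final_diagonal_lim:
  fixes f :: "nat \<times> nat \<Rightarrow> complex"
  assumes f: "f summable_on diagonal d"
  shows "(\<lambda>k. infsum f {x \<in> diagonal d. k < fst x}) \<longlonglongrightarrow> 0"
proof -
  have "infsum f {x \<in> diagonal d. k < fst x}
      = infsum f (diagonal d) - infsum f {x \<in> diagonal d. fst x \<le> k}" for k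
  proof -
    have split: "diagonal d = {x \<in> diagonal d. fst x \<le> k} \<union> {x \<in> diagonal d. k < fst x}"
      by auto
    have "infsum f (diagonal d)
        = infsum f {x \<in> diagonal d. fst x \<le> k} + infsum f {x \<in> diagonal d. k < fst x}"
      by (subst split, rule infsum_Un_disjoint)
        (auto intro: summable_on_subset_banach[OF f])
    then show ?thesis
      by simp
  qed
  moreover have "(\<lambda>k. infsum f (diagonal d) - infsum f {x \<in> diagonal d. fst x \<le> k})
      \<longlonglongrightarrow> infsum f (diagonal d) - infsum f (diagonal d)"
    by (intro tendsto_diff tendsto_const infsum_initial_diagonal_lim f)
  ultimately show ?thesis
    by simp
qed

text \<open>
  For \<open>d \<ge> 0\<close> this is the matrix of \<open>U\<^sub>W\<^sup>d\<close>, and for \<open>d \<le> 0\<close> that of \<open>(U\<^sub>W\<^sup>*)\<^sup>-\<^sup>d\<close>.  The former span the kernel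
  of \<open>D\<close>, the latter represent the boundary values of \<open>primitive\<close>.
\<close>

definition shift_power :: "int \<Rightarrow> cmat"
  where "shift_power d = (\<lambda>i j. if int i - int j = d
    then complex_of_real (wprod (max i j) / wprod (min i j)) else 0)"

lemma entry_shift_power: "entry (shift_power d) x = (if offset x = d
    then complex_of_real (wprod (max (fst x) (snd x)) / wprod (min (fst x) (snd x))) else 0)"
  by (simp add: entry_def shift_power_def offset_def)

lemma shift_power_mem: "shift_power d \<in> nc_space w"
proof -
  obtain L where L: "\<And>i j. wprod i \<le> L ^ nat \<bar>int i - int j\<bar> * wprod j"
    using wprod_le_power by blast
  define K where "K = L ^ nat \<bar>d\<bar>"
  have le: "energy (shift_power d) x \<le> K\<^sup>2 * (if offset x = d then wt x else 0)" for x
  proof (cases "offset x = d")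
    case True
    let ?r = "wprod (max (fst x) (snd x)) / wprod (min (fst x) (snd x))"
    have "\<bar>int (max (fst x) (snd x)) - int (min (fst x) (snd x))\<bar> = \<bar>d\<bar>"
      using True by (auto simp: offset_def max_def min_def)
    then have "?r \<le> K"
      using L[of "max (fst x) (snd x)" "min (fst x) (snd x)"] by (simp add: K_def pos_divide_le_eq)
    then have "?r\<^sup>2 \<le> K\<^sup>2"
      by (intro power_mono) auto
    then have "wt x * ?r\<^sup>2 \<le> wt x * K\<^sup>2"
      by (intro mult_left_mono) auto
    moreover have "cmod (entry (shift_power d) x) = ?r"
      using True by (simp add: entry_shift_power norm_divide)
    ultimately show ?thesis
      using True by (simp add: energy_def mult.commute)
  next
    case False
    then show ?thesis
      by (simp add: energy_def entry_shift_power)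
  qed
  have "sum (energy (shift_power d)) G \<le> K\<^sup>2 * diag_weight d" if G: "finite G" for G
  proof -
    have "sum (energy (shift_power d)) G \<le> (\<Sum>x\<in>G. K\<^sup>2 * (if offset x = d then wt x else 0))"
      by (intro sum_mono le)
    also have "\<dots> = K\<^sup>2 * sum wt {x \<in> G. offset x = d}"
      using G by (simp add: sum_distrib_left[symmetric] sum.inter_filter)
    also have "\<dots> \<le> K\<^sup>2 * diag_weight d"
      by (intro mult_left_mono sum_wt_le_diag_weight G) simp
    finally show ?thesis .
  qed
  then show ?thesis
    by (rule nc_spaceI)
qed

lemma nc_inner_shift_power:
  assumes b: "b \<in> nc_space w" and d: "d \<le> 0"
  shows "nc_inner w (shift_power d) b = infsum (increment b) (diagonal d)"
  unfolding nc_inner_infsum[OF shift_power_mem b]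
  by (rule infsum_cong_neutral)
    (use d in \<open>auto simp: entry_shift_power increment_def offset_def max_def min_def\<close>)

lemma shift_power_orthogonal: "d \<noteq> e \<Longrightarrow> nc_inner w (shift_power d) (shift_power e) = 0"
  unfolding nc_inner_infsum[OF shift_power_mem shift_power_mem]
  by (intro infsum_0) (simp add: entry_shift_power)

lemma shift_power_nonzero: "shift_power d \<noteq> 0"
proof -
  \<comment> \<open>The first entry of the diagonal is \<open>(d, 0)\<close> or \<open>(0, -d)\<close>.\<close>
  have "entry (shift_power d) (nat d, nat (- d)) \<noteq> entry 0 (nat d, nat (- d))"
    by (simp add: entry_shift_power offset_def)
  then show ?thesis
    by metis
qed

lemma inj_shift_power: "inj shift_power"
proof (rule injI, rule ccontr)
  fix d e assume "shift_power d = shift_power e" "d \<noteq> e"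
  then have "nc_inner w (shift_power d) (shift_power d) = 0"
    using shift_power_orthogonal[of d e] by simp
  then show False
    using H.ip_self_eq_0[OF shift_power_mem] shift_power_nonzero by blast
qed

lemma orth_family_shift_power: "finite I \<Longrightarrow> H.orth_family (shift_power ` I)"
  unfolding H.orth_family_def
proof (intro conjI ballI impI)
  show "finite (shift_power ` I)" if "finite I"
    using that by (rule finite_imageI)
  show "shift_power ` I \<subseteq> nc_space w"
    using shift_power_mem by (rule image_subsetI)
  show "0 \<notin> shift_power ` I"
    using shift_power_nonzero by (metis imageE)
  fix e f assume "e \<in> shift_power ` I" "f \<in> shift_power ` I" "e \<noteq> f"
  then obtain c d where "e = shift_power c" "f = shift_power d" "c \<noteq> d"
    by blast
  then show "nc_inner w e f = 0"
    by (simp add: shift_power_orthogonal)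
qed

text \<open>
  For \<open>d \<ge> 0\<close> the coefficient is a tail of a convergent series, for \<open>d < 0\<close> an initial partial sum whose limit
  is the sum over the whole diagonal \<open>d + 1\<close>, that is, an inner product with \<open>shift_power (d + 1)\<close>.
\<close>

lemma fourier_primitive_lim:
  assumes b: "b \<in> nc_space w"
  shows "fourier (primitive b) d \<longlonglongrightarrow>
    (if 0 \<le> d then 0 else complex_of_real (1 / w_inf ^ nat (- d)) * nc_inner w (shift_power (d + 1)) b)"
proof (cases "0 \<le> d")
  case True
  have "conjugated (primitive b) (k + nat d) k = - infsum (increment b) {x \<in> diagonal (d + 1). k + nat d < fst x}" for k
    using True by (simp add: conjugated_primitive half_diagonal_def)
  then have eq: "fourier (primitive b) d = (\<lambda>k. complex_of_real (wprod (k + nat d) / wprod k)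
      * - infsum (increment b) {x \<in> diagonal (d + 1). k + nat d < fst x})"
    by (intro ext) (simp only: fourier_conjugated(1)[OF True])
  have "(\<lambda>k. infsum (increment b) {x \<in> diagonal (d + 1). k + nat d < fst x}) \<longlonglongrightarrow> 0"
    by (rule LIMSEQ_ignore_initial_segment[OF infsum_final_diagonal_lim])
      (rule increment_summable[OF b subset_refl])
  then have "fourier (primitive b) d \<longlonglongrightarrow> complex_of_real (w_inf ^ nat d) * - 0"
    unfolding eq by (intro tendsto_mult tendsto_minus tendsto_of_real wprod_ratio_lim)
  then show ?thesis
    using True by simp
next
  case False
  then have d: "d < 0"
    by simp
  have "conjugated (primitive b) k (k + nat (- d)) = infsum (increment b) {x \<in> diagonal (d + 1). fst x \<le> k}" for k
    using d by (simp add: conjugated_primitive half_diagonal_def)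
  then have eq: "fourier (primitive b) d = (\<lambda>k. complex_of_real (1 / (wprod (k + nat (- d)) / wprod k))
      * infsum (increment b) {x \<in> diagonal (d + 1). fst x \<le> k})"
    by (intro ext) (simp only: fourier_conjugated(2)[OF d])
  have "fourier (primitive b) d \<longlonglongrightarrow>
      complex_of_real (1 / w_inf ^ nat (- d)) * infsum (increment b) (diagonal (d + 1))"
    unfolding eq
    by (intro tendsto_mult tendsto_of_real tendsto_divide tendsto_const wprod_ratio_lim
        infsum_initial_diagonal_lim increment_summable[OF b subset_refl]) simp
  then show ?thesis
    using d by (simp add: nc_inner_shift_power[OF b])
qed

subsection \<open>The kernel\<close>

text \<open>
  If \<open>D z = 0\<close>, then \<open>\<Pi>\<^sup>-\<^sup>1 z \<Pi>\<close> is constant on each diagonal \<open>d \<ge> 0\<close>.  On the diagonals \<open>d < 0\<close> the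
  recursion starts from the value zero in row \<open>0\<close>.
\<close>

lemma conjugated_kernel:
  assumes "D_op w z = 0"
  shows "conjugated z i j = (if i < j then 0 else conjugated z (i - j) 0)"
proof -
  have step: "conjugated z i (Suc j) = (if i = 0 then 0 else conjugated z (i - 1) j)" for i j
  proof -
    have "complex_of_real (wprod i / wprod j / wt (i, j)) \<noteq> 0"
      using less_imp_neq[OF wt_pos[of "(i, j)"]] by simp
    then show ?thesis
      using D_op_conjugated[of z i j] assms by (simp add: zero_fun_apply)
  qed
  show ?thesis
  proof (induction j arbitrary: i)
    case (Suc j)
    show ?case
      unfolding step using Suc[of "i - 1"] by (cases i) auto
  qed simp
qed

lemma conjugated_shift_power: "0 \<le> d \<Longrightarrow> conjugated (shift_power d) i j = (if int i - int j = d then 1 else 0)"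
  by (auto simp: conjugated_def shift_power_def max_def min_def)

lemma D_op_shift_power: "0 \<le> d \<Longrightarrow> D_op w (shift_power d) = 0"
  by (intro ext) (auto simp: D_op_conjugated conjugated_shift_power)

lemma fourier_kernel_lim:
  assumes "D_op w z = 0"
  shows "fourier z d \<longlonglongrightarrow> (if 0 \<le> d then complex_of_real (w_inf ^ nat d) * conjugated z (nat d) 0 else 0)"
proof (cases "0 \<le> d")
  case True
  have "conjugated z (k + nat d) k = conjugated z (nat d) 0" for k
    by (subst conjugated_kernel[OF assms]) simp
  then have "fourier z d = (\<lambda>k. complex_of_real (wprod (k + nat d) / wprod k) * conjugated z (nat d) 0)"
    by (intro ext) (simp only: fourier_conjugated(1)[OF True])
  moreover have "(\<lambda>k. complex_of_real (wprod (k + nat d) / wprod k) * conjugated z (nat d) 0)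
      \<longlonglongrightarrow> complex_of_real (w_inf ^ nat d) * conjugated z (nat d) 0"
    by (intro tendsto_mult tendsto_of_real wprod_ratio_lim tendsto_const)
  ultimately show ?thesis
    using True by simp
next
  case False
  then have "conjugated z k (k + nat (- d)) = 0" for k
    by (subst conjugated_kernel[OF assms]) simp
  then have "fourier z d = (\<lambda>k. 0)"
    using False by (intro ext) (simp add: fourier_conjugated(2))
  then show ?thesis
    using False by simp
qed

lemma entry_sum: "finite I \<Longrightarrow> entry (sum f I) x = (\<Sum>i\<in>I. entry (f i) x)"
proof (induction I rule: finite_induct)
  case empty
  show ?case
    unfolding sum.empty entry_simps ..
next
  case (insert i I)
  show ?case
    unfolding sum.insert[OF insert(1,2)] entry_simps insert(3) ..
qed

lemma span_shift_power_nonneg: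
  "cmat.span (shift_power ` {0..N}) =
    {z \<in> nc_space w. D_op w z = 0 \<and> (\<forall>m. N < int m \<longrightarrow> conjugated z m 0 = 0)}" (is "_ = ?Z")
proof
  have conjugated_lin: "conjugated 0 p q = 0" "conjugated (a + b) p q = conjugated a p q + conjugated b p q"
    "conjugated (mscale z a) p q = z * conjugated a p q"
    for a b z p q
    by (simp_all add: conjugated_def mscale_def distrib_left)
  have sub: "cmat.subspace ?Z"
  proof (rule cmat.subspaceI)
    show "0 \<in> ?Z"
      using D_op_diff[of 0 0] by (simp add: conjugated_lin)
    show "a + b \<in> ?Z" if "a \<in> ?Z" "b \<in> ?Z" for a b
      using that by (simp add: conjugated_lin D_op_add)
    show "mscale z a \<in> ?Z" if "a \<in> ?Z" for z a
      using that by (simp add: conjugated_lin D_op_mscale)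
  qed
  show "cmat.span (shift_power ` {0..N}) \<subseteq> ?Z"
  proof (rule cmat.span_minimal[OF _ sub])
    show "shift_power ` {0..N} \<subseteq> ?Z"
      using shift_power_mem by (auto simp: D_op_shift_power conjugated_shift_power)
  qed
  show "?Z \<subseteq> cmat.span (shift_power ` {0..N})"
  proof
    fix z assume z: "z \<in> ?Z"
    have "z = (\<Sum>d\<in>{0..N}. mscale (conjugated z (nat d) 0) (shift_power d))"
    proof (rule entry_eqI)
      fix x :: "nat \<times> nat"
      obtain i j where x: "x = (i, j)"
        by (cases x)
      have "entry (\<Sum>d\<in>{0..N}. mscale (conjugated z (nat d) 0) (shift_power d)) x
          = (\<Sum>d\<in>{0..N}. if d = offset x then conjugated z (nat d) 0 * entry (shift_power d) x else 0)"
        unfolding entry_sum[OF finite_atLeastAtMost_int] entry_simps by (intro sum.cong) (auto simp: entry_shift_power)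
      also have "\<dots> = (if offset x \<in> {0..N} then conjugated z (nat (offset x)) 0 * entry (shift_power (offset x)) x else 0)"
        by simp
      also have "\<dots> = entry z x"
      proof (cases "i < j")
        case True
        then have "z i j = 0"
          using z conjugated_kernel[of z i j] entry_eq_conjugated[of z i j] by simp
        then show ?thesis
          using True by (simp add: x offset_def entry_def)
      next
        case False
        then have n: "nat (int i - int j) = i - j" and max: "max i j = i" "min i j = j"
          by auto
        have "z i j = complex_of_real (wprod i / wprod j) * conjugated z (i - j) 0"
          using z conjugated_kernel[of z i j] entry_eq_conjugated[of z i j] False by simp
        moreover have "conjugated z (i - j) 0 = 0" if "\<not> int i - int j \<le> N"
          using z that False by (auto simp: of_nat_diff)
        ultimately show ?thesis
          using False n max by (auto simp: x offset_def entry_def shift_power_def)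
      qed
      finally show "entry z x = entry (\<Sum>d\<in>{0..N}. mscale (conjugated z (nat d) 0) (shift_power d)) x" ..
    qed
    also have "\<dots> \<in> cmat.span (shift_power ` {0..N})"
      by (intro cmat.span_sum cmat.span_scale cmat.span_base imageI)
    finally show "z \<in> cmat.span (shift_power ` {0..N})" .
  qed
qed

subsection \<open>The domain of the boundary value problem\<close>

lemma boundary_coeff_decomposed:
  assumes z: "D_op w z = 0" and b: "b \<in> nc_space w"
  shows "boundary_coeff (z + primitive b) d = (if 0 \<le> d then complex_of_real (w_inf ^ nat d) * conjugated z (nat d) 0
    else complex_of_real (1 / w_inf ^ nat (- d)) * nc_inner w (shift_power (d + 1)) b)"
proof -
  have "fourier (z + primitive b) d = (\<lambda>k. fourier z d k + fourier (primitive b) d k)"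
    by (simp add: fun_eq_iff fourier_def)
  then have "fourier (z + primitive b) d \<longlonglongrightarrow>
      (if 0 \<le> d then complex_of_real (w_inf ^ nat d) * conjugated z (nat d) 0 else 0)
      + (if 0 \<le> d then 0 else complex_of_real (1 / w_inf ^ nat (- d)) * nc_inner w (shift_power (d + 1)) b)"
    using tendsto_add[OF fourier_kernel_lim[OF z] fourier_primitive_lim[OF b]] by simp
  from limI[OF this] show ?thesis
    by (simp add: boundary_coeff_def)
qed

text \<open>
  The boundary conditions for \<open>d \<ge> 0\<close> only concern the kernel component \<open>z\<close>, and those for \<open>d < 0\<close> only
  concern \<open>D a\<close>.  As \<open>D\<close> raises the diagonal by one, the condition at \<open>d\<close> with \<open>N < d < 0\<close> is orthogonality to
  \<open>shift_power (d + 1)\<close>, which explains the range \<open>{N + 2..0}\<close>.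
\<close>

lemma dom_D_N_eq:
  "dom_D_N w N = {e + primitive b | e b. e \<in> cmat.span (shift_power ` {0..N}) \<and>
    b \<in> orth_complement (nc_space w) (nc_inner w) (shift_power ` {N + 2..0})}"
    (is "_ = ?V")
proof (intro equalityI subsetI)
  fix a assume a: "a \<in> dom_D_N w N"
  then have aX: "a \<in> nc_space w" and b: "D_op w a \<in> nc_space w"
    and bc: "\<And>d. N < d \<Longrightarrow> boundary_coeff a d = 0"
    by (auto simp: dom_D_N_def Dom_D_def)
  define z where "z = a - primitive (D_op w a)"
  have a_eq: "a = z + primitive (D_op w a)"
    by (simp add: z_def)
  have zX: "z \<in> nc_space w"
    unfolding z_def by (intro H.diff_mem aX primitive_mem b)
  have Dz: "D_op w z = 0"
    unfolding z_def D_op_diff D_op_primitive[OF b] by simp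
  note bc' = boundary_coeff_decomposed[OF Dz b, folded a_eq]
  have "conjugated z m 0 = 0" if "N < int m" for m
    using bc[OF that] bc'[of "int m"] by simp
  then have "z \<in> cmat.span (shift_power ` {0..N})"
    unfolding span_shift_power_nonneg using zX Dz by blast
  moreover have "nc_inner w (shift_power d) (D_op w a) = 0" if "d \<in> {N + 2..0}" for d
    using bc[of "d - 1"] bc'[of "d - 1"] that by simp
  then have "D_op w a \<in> orth_complement (nc_space w) (nc_inner w) (shift_power ` {N + 2..0})"
    unfolding orth_complement_def using b by blast
  ultimately show "a \<in> ?V"
    using a_eq by blast
next
  fix a assume "a \<in> ?V"
  then obtain z b where a: "a = z + primitive b"
    and z: "z \<in> cmat.span (shift_power ` {0..N})"
    and "b \<in> orth_complement (nc_space w) (nc_inner w) (shift_power ` {N + 2..0})"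
    by blast
  then have b: "b \<in> nc_space w"
    and orth: "\<And>d. d \<in> {N + 2..0} \<Longrightarrow> nc_inner w (shift_power d) b = 0"
    unfolding orth_complement_def by blast+
  have zX: "z \<in> nc_space w" and Dz: "D_op w z = 0" and hz: "\<And>m. N < int m \<Longrightarrow> conjugated z m 0 = 0"
    using z unfolding span_shift_power_nonneg by blast+
  have "a \<in> nc_space w"
    unfolding a by (intro H.add_mem zX primitive_mem b)
  moreover have "D_op w a = b"
    unfolding a D_op_add Dz D_op_primitive[OF b] by simp
  moreover have "boundary_coeff a d = 0" if "N < d" for d
    unfolding a boundary_coeff_decomposed[OF Dz b] using hz[of "nat d"] orth[of "d + 1"] that by simp
  ultimately show "a \<in> dom_D_N w N"
    using b by (simp add: dom_D_N_def Dom_D_def)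
qed

lemma finite_support_mem:
  assumes "finite {x. entry a x \<noteq> 0}"
  shows "a \<in> nc_space w"
proof (rule nc_spaceI)
  fix F :: "(nat \<times> nat) set" assume F: "finite F"
  have "sum (energy a) F = sum (energy a) (F \<inter> {x. entry a x \<noteq> 0})"
    using F by (intro sum.mono_neutral_right) (auto simp: energy_def)
  also have "\<dots> \<le> sum (energy a) {x. entry a x \<noteq> 0}"
    using assms by (intro sum_mono2) auto
  finally show "sum (energy a) F \<le> sum (energy a) {x. entry a x \<noteq> 0}" .
qed

lemma finite_support_in_dom:
  assumes fin: "finite {x. entry a x \<noteq> 0}"
  shows "a \<in> dom_D_N w N"
proof -
  let ?S = "{x. entry a x \<noteq> 0}"
  have "{x. entry (D_op w a) x \<noteq> 0} \<subseteq> (\<lambda>(i, j). (i, j - 1)) ` ?S \<union> (\<lambda>(i, j). (Suc i, j)) ` ?S"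
  proof
    fix x assume "x \<in> {x. entry (D_op w a) x \<noteq> 0}"
    moreover obtain i j where x: "x = (i, j)"
      by (cases x)
    ultimately have "a i (Suc j) \<noteq> 0 \<or> i \<noteq> 0 \<and> a (i - 1) j \<noteq> 0"
      by (auto simp: entry_def D_op_entry split: if_splits)
    then show "x \<in> (\<lambda>(i, j). (i, j - 1)) ` ?S \<union> (\<lambda>(i, j). (Suc i, j)) ` ?S"
    proof
      assume "a i (Suc j) \<noteq> 0"
      then show ?thesis
        by (intro UnI1 image_eqI[of _ _ "(i, Suc j)"]) (simp_all add: x entry_def)
    next
      assume "i \<noteq> 0 \<and> a (i - 1) j \<noteq> 0"
      then show ?thesis
        by (intro UnI2 image_eqI[of _ _ "(i - 1, j)"]) (simp_all add: x entry_def)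
    qed
  qed
  then have "finite {x. entry (D_op w a) x \<noteq> 0}"
    by (rule finite_subset) (use fin in simp)
  moreover have "boundary_coeff a d = 0" for d
  proof -
    have "finite (fst ` ?S)"
      using fin by simp
    then obtain n where n: "fst ` ?S \<subseteq> {..<n}"
      unfolding finite_nat_iff_bounded ..
    have "a i j = 0" if "n \<le> i" for i j
    proof (rule ccontr)
      assume "a i j \<noteq> 0"
      then have "fst (i, j) \<in> fst ` ?S"
        by (intro imageI) (simp add: entry_def)
      then show False
        using n that by auto
    qed
    then have "fourier a d k = 0" if "n \<le> k" for k
      using that by (simp add: fourier_def)
    then have "fourier a d \<longlonglongrightarrow> 0"
      by (intro tendsto_eventually eventually_sequentiallyI[of n])
    then show ?thesis
      by (simp add: boundary_coeff_def limI)
  qed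
  ultimately show ?thesis
    using finite_support_mem[OF fin] by (simp add: dom_D_N_def Dom_D_def finite_support_mem)
qed

text \<open>
  If \<open>N \<ge> -1\<close>, the second family is empty, and if \<open>N \<le> -1\<close>, the first one is; this gives the index
  \<open>N + 1\<close> in all cases.
\<close>

theorem d_bar_fredholm:
  shows "fredholm (nc_space w) (nc_inner w) (dom_D_N w N) (D_op w)"
    and "fredholm_index (nc_space w) (nc_inner w) (dom_D_N w N) (D_op w) = N + 1"
    and "\<exists>Q. bounded_operator (nc_space w) (nc_inner w) Q \<and>
      op_kernel (nc_space w) Q = op_coker (nc_space w) (nc_inner w) (dom_D_N w N) (D_op w) \<and>
      (\<forall>a\<in>nc_space w. Q a \<in> dom_D_N w N \<and>
        D_op w (Q a) =
          a - orth_proj (nc_inner w) (op_coker (nc_space w) (nc_inner w) (dom_D_N w N) (D_op w)) a) \<and>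
      (\<forall>a\<in>dom_D_N w N.
        Q (D_op w a) = a - orth_proj (nc_inner w) (op_kernel (dom_D_N w N) (D_op w)) a) \<and>
      compact_operator (nc_space w) (nc_inner w) Q"
proof -
  let ?E = "shift_power ` {0..N}" and ?C = "shift_power ` {N + 2..0}"
  obtain B where B: "\<And>b. b \<in> nc_space w \<Longrightarrow> nrm (primitive b) \<le> B * nrm b"
    using primitive_bounded by blast
  obtain T where T: "compactin H.M.mtopology T" "primitive ` {b \<in> nc_space w. nrm b \<le> 1} \<subseteq> T"
    using primitive_ball_compact .
  have A: "D_op w (e + primitive b) = b"
    if "e \<in> cmat.span ?E" "b \<in> orth_complement (nc_space w) (nc_inner w) ?C" for e b
  proof -
    have "D_op w e = 0" "b \<in> nc_space w"
      using that unfolding span_shift_power_nonneg orth_complement_def by blast+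
    then show ?thesis
      unfolding D_op_add by (simp add: D_op_primitive)
  qed
  have dense: "densely_defined (nc_space w) (nc_inner w) (dom_D_N w N)"
  proof (rule densely_definedI)
    show "dom_D_N w N \<subseteq> nc_space w"
      by (auto simp: dom_D_N_def Dom_D_def)
  qed (rule finite_support_in_dom)
  note main = H.fredholm_of_compact_right_inverse[OF orth_family_shift_power
      orth_family_shift_power operator_on_primitive B T
      dom_D_N_eq A dense, OF finite_atLeastAtMost_int finite_atLeastAtMost_int]
  show "fredholm (nc_space w) (nc_inner w) (dom_D_N w N) (D_op w)"
    by (rule main(1))
  have card: "card (shift_power ` I) = card I" for I
    by (rule card_image) (rule inj_on_subset[OF inj_shift_power subset_UNIV])
  show "fredholm_index (nc_space w) (nc_inner w) (dom_D_N w N) (D_op w) = N + 1"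
  proof -
    have "fredholm_index (nc_space w) (nc_inner w) (dom_D_N w N) (D_op w) = int (card ?E) - int (card ?C)"
      by (rule main(2))
    then show ?thesis
      by (simp add: card)
  qed
  show "\<exists>Q. bounded_operator (nc_space w) (nc_inner w) Q \<and>
      op_kernel (nc_space w) Q = op_coker (nc_space w) (nc_inner w) (dom_D_N w N) (D_op w) \<and>
      (\<forall>a\<in>nc_space w. Q a \<in> dom_D_N w N \<and>
        D_op w (Q a) =
          a - orth_proj (nc_inner w) (op_coker (nc_space w) (nc_inner w) (dom_D_N w N) (D_op w)) a) \<and>
      (\<forall>a\<in>dom_D_N w N.
        Q (D_op w a) = a - orth_proj (nc_inner w) (op_kernel (dom_D_N w N) (D_op w)) a) \<and>
      compact_operator (nc_space w) (nc_inner w) Q"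
    by (rule main(3))
qed

end

section \<open>The standing assumptions\<close>

lemma mapply_S_op: "mapply (S_op w) x = (\<lambda>i. complex_of_real (s_seq w i) * x i)"
proof
  fix i
  show "mapply (S_op w) x i = complex_of_real (s_seq w i) * x i"
    unfolding mapply_def S_op_eq_mdiag
    by (subst infsum_single[of i]) (auto simp: mdiag_def)
qed

text \<open>
  Evaluate the quadratic form of \<open>S\<close> and \<open>S\<close> itself at the basis vector \<open>e\<^sub>k\<close>.
\<close>

lemma s_seq_pos:
  assumes pos: "positive_operator (S_op w)" and inj: "inj_on (mapply (S_op w)) ell2"
  shows "0 < s_seq w k"
proof -
  define u :: "nat \<Rightarrow> complex" where "u n = (if n = k then 1 else 0)" for n
  have "(\<lambda>n. (cmod (u n))\<^sup>2) summable_on UNIV \<longleftrightarrow> (\<lambda>n. (cmod (u n))\<^sup>2) summable_on {k}"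
    by (rule summable_on_cong_neutral) (auto simp: u_def)
  then have u: "u \<in> ell2"
    by (simp add: ell2_def)
  have "ell2_inner u (mapply (S_op w) u) = complex_of_real (s_seq w k)"
    unfolding ell2_inner_def mapply_S_op by (subst infsum_single[of k]) (auto simp: u_def)
  then have "0 \<le> s_seq w k"
    using pos u by (auto simp: positive_operator_def)
  moreover have "s_seq w k \<noteq> 0"
  proof
    assume "s_seq w k = 0"
    then have "mapply (S_op w) u = mapply (S_op w) (\<lambda>n. 0)"
      by (auto simp: mapply_S_op u_def fun_eq_iff)
    moreover have "(\<lambda>n. 0) \<in> ell2"
      by (simp add: ell2_def)
    ultimately have "u = (\<lambda>n. 0)"
      using inj u by (auto dest: inj_onD)
    then have "u k = 0"
      by simp
    then show False
      by (simp add: u_def)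
  qed
  ultimately show ?thesis
    by simp
qed

theorem theorem6p1:
  fixes w :: "nat \<Rightarrow> real" and N :: int
  assumes "bounded (range w)"
    and "\<forall>k. w k > 0"
    and "\<exists>\<epsilon>>0. \<forall>k. w k \<ge> \<epsilon>"
    and "positive_operator (S_op w)"
    and "inj_on (mapply (S_op w)) ell2"
  shows "fredholm (nc_space w) (nc_inner w) (dom_D_N w N) (D_op w) \<and>
    fredholm_index (nc_space w) (nc_inner w) (dom_D_N w N) (D_op w) = N + 1 \<and>
    (\<exists>Q. bounded_operator (nc_space w) (nc_inner w) Q \<and>
      op_kernel (nc_space w) Q = op_coker (nc_space w) (nc_inner w) (dom_D_N w N) (D_op w) \<and>
      (\<forall>a\<in>nc_space w. Q a \<in> dom_D_N w N \<and>
        D_op w (Q a) =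
          a - orth_proj (nc_inner w) (op_coker (nc_space w) (nc_inner w) (dom_D_N w N) (D_op w)) a) \<and>
      (\<forall>a\<in>dom_D_N w N.
        Q (D_op w a) = a - orth_proj (nc_inner w) (op_kernel (dom_D_N w N) (D_op w)) a) \<and>
      compact_operator (nc_space w) (nc_inner w) Q)"
proof -
  obtain \<epsilon> where "0 < \<epsilon>" "\<And>k. \<epsilon> \<le> w k"
    using assms(3) by blast
  then interpret nc_disk w \<epsilon>
    using assms(1) s_seq_pos[OF assms(4,5)] by unfold_locales
  show ?thesis
    using d_bar_fredholm[of N] by (intro conjI)
qed

end
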